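(* Let $K$ be a field. For every $n\in\mathbb N=\{0,1,2,\dots\}$, there exists a finite simple graph $G$ such that $\mathrm{reg}(S/J_G)-\mathrm{v}(J_G)=n$. Moreover, for every $n\in\mathbb N$, there exists a finite simple graph $G$ such that $\mathrm{reg}(S/J_G)-\mathrm{v}_\emptyset(J_G)=n$.
   Context: For a finite simple graph $G$ on $V(G)=[m]$, put $S=K[x_1,\dots,x_m,y_1,\dots,y_m]$ (standard grading; $S$ depends on $G$), $f_{ij}=x_iy_j-x_jy_i$, and let $J_G=\langle f_{ij}\mid \{i,j\}\in E(G), i<j\rangle$ be the binomial edge ideal. $\mathrm{reg}$ denotes Castelnuovo–Mumford regularity. For a proper graded ideal $I$ of $S$ and $\mathfrak p\in\mathrm{Ass}(I)$ (associated primes of $S/I$), $\mathrm{v}_{\mathfrak p}(I)=\min\{d\ge 0\mid \exists f\in S_d \text{ with } (I:f)=\mathfrak p\}$ and $\mathrm{v}(I)=\min\{\mathrm{v}_{\mathfrak p}(I)\mid \mathfrak p\in \mathrm{Ass}(I)\}$. $P_\emptyset(G)$ is the ideal generated by all $f_{ij}$ with $i<j$ in the same connected component of $G$; it is an associated prime of $J_G$, and $\mathrm{v}_\emptyset(J_G)=\mathrm{v}_{P_\emptyset(G)}(J_G)$. *)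

theory Defs
  imports
    "HOL-Library.Poly_Mapping"
    "HOL-Algebra.Ideal"
    "Jordan_Normal_Form.Matrix"
begin

section \<open>The polynomial rings \<open>S = K[x\<^sub>1, \<dots>, x\<^sub>m, y\<^sub>1, \<dots>, y\<^sub>m]\<close>\<close>

text \<open>
  The number of variables varies with the graph, so all the rings live inside one type of
  polynomials in the variables \<open>x\<^sub>i, y\<^sub>i\<close> with \<open>i\<close> ranging over \<^typ>\<open>nat\<close>; the ring \<open>poly_ring m\<close> consists
  of those polynomials that only involve variables with index in \<open>{1..m}\<close>.
\<close>

datatype var = Xvar nat | Yvar nat

type_synonym monom = "var \<Rightarrow>\<^sub>0 nat"
type_synonym 'k pol = "monom \<Rightarrow>\<^sub>0 'k"

definition vars :: "nat \<Rightarrow> var set" where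
  "vars m = Xvar ` {1..m} \<union> Yvar ` {1..m}"

definition poly_ring :: "nat \<Rightarrow> 'k::comm_ring_1 pol ring" where
  "poly_ring m = \<lparr>carrier = {p. \<forall>t\<in>Poly_Mapping.keys p. Poly_Mapping.keys t \<subseteq> vars m},
          monoid.mult = (*), one = 1, zero = 0, add = (+)\<rparr>"

lemma cring_poly_ring: "cring (poly_ring m :: 'k::comm_ring_1 pol ring)"
proof -
  let ?R = "poly_ring m :: 'k pol ring"
  have add: "p + q \<in> carrier ?R" if "p \<in> carrier ?R" "q \<in> carrier ?R" for p q
    using that Poly_Mapping.keys_add[of p q] by (force simp: poly_ring_def)
  have mult: "p * q \<in> carrier ?R" if "p \<in> carrier ?R" "q \<in> carrier ?R" for p q
  proof -
    have "Poly_Mapping.keys t \<subseteq> vars m" if t: "t \<in> Poly_Mapping.keys (p * q)" for t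
    proof -
      obtain a b where "t = a + b" "a \<in> Poly_Mapping.keys p" "b \<in> Poly_Mapping.keys q"
        using t Poly_Mapping.keys_mult[of p q] by blast
      then show ?thesis
        using \<open>p \<in> carrier ?R\<close> \<open>q \<in> carrier ?R\<close> Poly_Mapping.keys_add[of a b]
        by (fastforce simp: poly_ring_def)
    qed
    then show ?thesis by (simp add: poly_ring_def)
  qed
  have neg: "- p \<in> carrier ?R" if "p \<in> carrier ?R" for p
    using that by (simp add: poly_ring_def)
  have zero: "0 \<in> carrier ?R" and one: "1 \<in> carrier ?R"
    by (simp_all add: poly_ring_def)
  have ops: "monoid.mult ?R = (*)" "\<one>\<^bsub>?R\<^esub> = 1" "ring.add ?R = (+)" "ring.zero ?R = 0"
    by (simp_all add: poly_ring_def)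
  show ?thesis
  proof (rule cringI)
    show "abelian_group ?R"
    proof (rule abelian_groupI)
      show "\<exists>q\<in>carrier ?R. q \<oplus>\<^bsub>?R\<^esub> p = \<zero>\<^bsub>?R\<^esub>" if "p \<in> carrier ?R" for p
        using neg[OF that] by (intro bexI[of _ "- p"]) (simp_all add: ops)
    qed (use add zero in \<open>simp_all add: ops algebra_simps\<close>)
    show "comm_monoid ?R"
      by (rule comm_monoidI) (use mult one in \<open>simp_all add: ops algebra_simps\<close>)
  qed (simp add: ops algebra_simps)
qed

definition var_pol :: "var \<Rightarrow> 'k::comm_ring_1 pol" where
  "var_pol v = Poly_Mapping.single (Poly_Mapping.single v 1) 1"

definition deg_monom :: "monom \<Rightarrow> nat" where
  "deg_monom t = (\<Sum>v\<in>Poly_Mapping.keys t. Poly_Mapping.lookup t v)"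

text \<open>
  The graded piece \<open>S\<^sub>d\<close>. It contains \<open>0\<close> for every \<open>d\<close> and is \<open>{0}\<close> for \<open>d < 0\<close>.
\<close>
definition graded_piece :: "nat \<Rightarrow> int \<Rightarrow> 'k::comm_ring_1 pol set" where
  "graded_piece m d = {p \<in> carrier (poly_ring m). \<forall>t\<in>Poly_Mapping.keys p. int (deg_monom t) = d}"

text \<open>The ideal of the polynomials without constant term, \<open>\<Oplus>\<^bsub>d>0\<^esub> S\<^sub>d\<close>.\<close>
definition irrelevant_ideal :: "nat \<Rightarrow> 'k::comm_ring_1 pol set" where
  "irrelevant_ideal m = {p \<in> carrier (poly_ring m). Poly_Mapping.lookup p 0 = 0}"

section \<open>Associated primes and v-numbers\<close>

definition colon :: "nat \<Rightarrow> 'k::comm_ring_1 pol set \<Rightarrow> 'k pol \<Rightarrow> 'k pol set" where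
  "colon m I f = {g \<in> carrier (poly_ring m). g * f \<in> I}"

definition Ass :: "nat \<Rightarrow> 'k::comm_ring_1 pol set \<Rightarrow> 'k pol set set" where
  "Ass m I = {P. primeideal P (poly_ring m) \<and> (\<exists>f\<in>carrier (poly_ring m). colon m I f = P)}"

text \<open>
  Both minima below are taken over nonempty sets whenever \<open>I\<close> is a proper graded ideal and
  \<open>P \<in> Ass m I\<close>.
\<close>
definition v_at :: "nat \<Rightarrow> 'k::comm_ring_1 pol set \<Rightarrow> 'k pol set \<Rightarrow> nat" where
  "v_at m P I = (LEAST d. \<exists>f\<in>graded_piece m (int d). colon m I f = P)"

definition v_number :: "nat \<Rightarrow> 'k::comm_ring_1 pol set \<Rightarrow> nat" where
  "v_number m I = (LEAST d. \<exists>P\<in>Ass m I. d = v_at m P I)"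

section \<open>Castelnuovo--Mumford regularity\<close>

text \<open>
  A graded free resolution \<open>\<cdots> \<rightarrow> F\<^sub>2 \<rightarrow> F\<^sub>1 \<rightarrow> F\<^sub>0 \<rightarrow> S/I \<rightarrow> 0\<close> by free modules of finite rank is
  given by the following data. The list \<open>a i\<close> contains the shifts of
  \<open>F\<^sub>i = \<Oplus>\<^sub>k S(-a i ! k)\<close>; the matrix \<open>D i\<close> describes the differential \<open>F\<^bsub>i+1\<^esub> \<rightarrow> F\<^sub>i\<close>; and the
  vector \<open>e\<close> consists of representatives in \<open>S\<close> of the images in \<open>S/I\<close> of the basis of \<open>F\<^sub>0\<close>, so that
  the augmentation \<open>F\<^sub>0 \<rightarrow> S/I\<close> sends \<open>v\<close> to the class of \<open>e \<bullet> v\<close>. As all maps are homogeneous of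
  degree \<open>0\<close>, the \<open>(k, l)\<close> entry of \<open>D i\<close> is a form of degree \<open>a (i+1) ! l - a i ! k\<close>.
\<close>

definition free_module :: "nat \<Rightarrow> nat \<Rightarrow> 'k::comm_ring_1 pol vec set" where
  "free_module m r = {v \<in> carrier_vec r. \<forall>k<r. v $ k \<in> carrier (poly_ring m)}"

definition graded_free_resolution ::
  "nat \<Rightarrow> 'k::comm_ring_1 pol set \<Rightarrow> (nat \<Rightarrow> int list) \<Rightarrow> 'k pol vec \<Rightarrow> (nat \<Rightarrow> 'k pol mat) \<Rightarrow> bool"
where
  "graded_free_resolution m I a e D \<longleftrightarrow>
    \<comment> \<open>the maps are homogeneous of degree \<open>0\<close>\<close>
    e \<in> carrier_vec (length (a 0)) \<and>
    (\<forall>k<length (a 0). e $ k \<in> graded_piece m (a 0 ! k)) \<and>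
    (\<forall>i. D i \<in> carrier_mat (length (a i)) (length (a (Suc i))) \<and>
      (\<forall>k<length (a i). \<forall>l<length (a (Suc i)).
        D i $$ (k, l) \<in> graded_piece m (a (Suc i) ! l - a i ! k))) \<and>
    \<comment> \<open>exactness at \<open>S/I\<close>, at \<open>F\<^sub>0\<close> and at \<open>F\<^bsub>i+1\<^esub>\<close>\<close>
    (\<forall>g\<in>carrier (poly_ring m). \<exists>v\<in>free_module m (length (a 0)). g - e \<bullet> v \<in> I) \<and>
    {v \<in> free_module m (length (a 0)). e \<bullet> v \<in> I} =
      (\<lambda>w. D 0 *\<^sub>v w) ` free_module m (length (a 1)) \<and>
    (\<forall>i. {v \<in> free_module m (length (a (Suc i))). D i *\<^sub>v v = 0\<^sub>v (length (a i))} =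
      (\<lambda>w. D (Suc i) *\<^sub>v w) ` free_module m (length (a (Suc (Suc i)))))"

definition minimal_graded_free_resolution ::
  "nat \<Rightarrow> 'k::comm_ring_1 pol set \<Rightarrow> (nat \<Rightarrow> int list) \<Rightarrow> 'k pol vec \<Rightarrow> (nat \<Rightarrow> 'k pol mat) \<Rightarrow> bool"
where
  "minimal_graded_free_resolution m I a e D \<longleftrightarrow>
    graded_free_resolution m I a e D \<and> (\<forall>i. elements_mat (D i) \<subseteq> irrelevant_ideal m)"

text \<open>
  The regularity of \<open>S/I\<close> is the maximum of \<open>j - i\<close> over all pairs \<open>(i, j)\<close> such that \<open>S(-j)\<close> is a
  summand of \<open>F\<^sub>i\<close>, i.e. such that the graded Betti number \<open>\<beta>\<^bsub>i,j\<^esub>(S/I)\<close> is nonzero, where \<open>F\<close> is the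
  minimal graded free resolution of \<open>S/I\<close>. This resolution exists for every graded ideal, it is
  unique up to isomorphism, and it has finite length by Hilbert's syzygy theorem; so for a proper
  graded ideal the description singles out exactly one integer.
\<close>
definition regularity :: "nat \<Rightarrow> 'k::field pol set \<Rightarrow> int" where
  "regularity m I = (THE r. \<exists>a e D. minimal_graded_free_resolution m I a e D \<and>
     r = Max {j - int i | i j. j \<in> set (a i)})"

section \<open>Binomial edge ideals\<close>

text \<open>A finite simple graph on \<open>{1..m}\<close> is given by its set of edges.\<close>
definition simple_graph :: "nat \<Rightarrow> nat set set \<Rightarrow> bool" where
  "simple_graph m E \<longleftrightarrow> (\<forall>e\<in>E. e \<subseteq> {1..m} \<and> card e = 2)"

definition connected_in :: "nat set set \<Rightarrow> nat \<Rightarrow> nat \<Rightarrow> bool" where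
  "connected_in E i j \<longleftrightarrow> (i, j) \<in> {(u, v). {u, v} \<in> E}\<^sup>*"

definition f_pol :: "nat \<Rightarrow> nat \<Rightarrow> 'k::comm_ring_1 pol" where
  "f_pol i j = var_pol (Xvar i) * var_pol (Yvar j) - var_pol (Xvar j) * var_pol (Yvar i)"

definition binomial_edge_ideal :: "nat \<Rightarrow> nat set set \<Rightarrow> 'k::comm_ring_1 pol set" where
  "binomial_edge_ideal m E = genideal (poly_ring m) {f_pol i j | i j. {i, j} \<in> E \<and> i < j}"

definition P_empty :: "nat \<Rightarrow> nat set set \<Rightarrow> 'k::comm_ring_1 pol set" where
  "P_empty m E = genideal (poly_ring m)
     {f_pol i j | i j. i \<in> {1..m} \<and> j \<in> {1..m} \<and> i < j \<and> connected_in E i j}"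

definition v_empty :: "nat \<Rightarrow> nat set set \<Rightarrow> 'k::comm_ring_1 pol set \<Rightarrow> nat" where
  "v_empty m E I = v_at m (P_empty m E) I"

end

theory Submission
  imports Defs
begin

text \<open>
  The witnesses are the disjoint unions of \<open>n\<close> edges (with one isolated vertex added, so that the
  vertex set is nonempty for \<open>n = 0\<close> as well). For such a graph \<open>G\<close> the binomial edge ideal is
  generated by \<open>n\<close> quadrics \<open>f\<^sub>1, \<dots>, f\<^sub>n\<close> in pairwise disjoint sets of variables, and it equals
  \<open>P\<^sub>\<emptyset>(G)\<close> because every component of \<open>G\<close> is complete. Two facts then give the theorem.

  \<^bold>\<open>The ideal is prime, so both v-numbers vanish.\<close> For every graph, \<open>P\<^sub>\<emptyset>(G)\<close> is the kernel of the
  substitution \<open>x\<^sub>i \<mapsto> a\<^sub>i s\<^sub>c, y\<^sub>i \<mapsto> a\<^sub>i t\<^sub>c\<close> with \<open>c\<close> the component of \<open>i\<close>, whose target is a polynomial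
  ring and hence a domain (\<open>primeideal_P_empty\<close>). If \<open>J\<close> is prime, then \<open>J : 1 = J\<close> exhibits \<open>J\<close> as an
  associated prime in degree \<open>0\<close> (\<open>prime_ideal_v_zero\<close>).

  \<^bold>\<open>The regularity is \<open>n\<close>.\<close> Since \<open>f\<^bsub>k+1\<^esub>\<close> lies outside the prime ideal
  \<open>(f\<^sub>1, \<dots>, f\<^sub>k)\<close>, it is a nonzerodivisor modulo that ideal. The mapping cone of multiplication by
  \<open>f\<^bsub>k+1\<^esub>\<close> therefore turns a minimal resolution for \<open>f\<^sub>1, \<dots>, f\<^sub>k\<close> into one for
  \<open>f\<^sub>1, \<dots>, f\<^bsub>k+1\<^esub>\<close> (\<open>mapping_cone_resolution\<close>, \<open>mapping_cone_minimal\<close>). Iterating builds the Koszul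
  complex, whose generators in homological degree \<open>i \<le> n\<close> all have internal degree \<open>2 i\<close>; the maximum of
  \<open>2 i - i\<close> is \<open>n\<close>. Regularity is defined by an arbitrary minimal resolution, so this computation counts
  only because any two minimal resolutions have the same shifts: the composite of comparison maps in
  both directions is homotopic to the identity, and modulo the variables the homotopy disappears
  (\<open>minimal_resolution_shifts_unique\<close>).
\<close>

section \<open>Polynomials as sums of terms\<close>

lemma sum_single_lookup:
  fixes p :: "'a \<Rightarrow>\<^sub>0 'b::comm_monoid_add"
  assumes "finite A" "Poly_Mapping.keys p \<subseteq> A"
  shows "(\<Sum>t\<in>A. Poly_Mapping.single t (Poly_Mapping.lookup p t)) = p"
proof (rule poly_mapping_eqI)
  fix u
  have "Poly_Mapping.lookup (\<Sum>t\<in>A. Poly_Mapping.single t (Poly_Mapping.lookup p t)) u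
    = (\<Sum>t\<in>A. if t = u then Poly_Mapping.lookup p t else 0)"
    by (simp add: lookup_sum lookup_single when_def)
  also have "\<dots> = Poly_Mapping.lookup p u"
    using assms by (auto simp: in_keys_iff)
  finally show "Poly_Mapping.lookup (\<Sum>t\<in>A. Poly_Mapping.single t (Poly_Mapping.lookup p t)) u
    = Poly_Mapping.lookup p u" .
qed

lemma poly_mapping_term_induct [case_names zero single add]:
  fixes p :: "'a \<Rightarrow>\<^sub>0 'b::comm_monoid_add"
  assumes zero: "P 0" and single: "\<And>t x. P (Poly_Mapping.single t x)"
    and add: "\<And>p q. P p \<Longrightarrow> P q \<Longrightarrow> P (p + q)"
  shows "P p"
proof -
  have "P (\<Sum>t\<in>A. Poly_Mapping.single t (Poly_Mapping.lookup p t))" if "finite A" for A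
    using that by induction (use assms in auto)
  then show ?thesis
    using sum_single_lookup[of "Poly_Mapping.keys p" p] by (metis finite_keys order_refl)
qed

lemma keys_add_nat: "Poly_Mapping.keys (s + t) = Poly_Mapping.keys s \<union> Poly_Mapping.keys t"
  for s t :: "'a \<Rightarrow>\<^sub>0 nat"
  by (auto simp: in_keys_iff lookup_add)

text \<open>
  Relabelling the keys of a finitely supported function, adding up the values of keys that get
  the same label. Applied to exponent vectors this substitutes variables for variables; applied to
  polynomials it substitutes monomials for monomials.
\<close>
definition push :: "('a \<Rightarrow> 'b) \<Rightarrow> ('a \<Rightarrow>\<^sub>0 'c::comm_monoid_add) \<Rightarrow> ('b \<Rightarrow>\<^sub>0 'c)" where
  "push g p = (\<Sum>v\<in>Poly_Mapping.keys p. Poly_Mapping.single (g v) (Poly_Mapping.lookup p v))"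

lemma push_superset:
  assumes "finite A" "Poly_Mapping.keys p \<subseteq> A"
  shows "push g p = (\<Sum>v\<in>A. Poly_Mapping.single (g v) (Poly_Mapping.lookup p v))"
  unfolding push_def using assms
  by (intro sum.mono_neutral_left) (auto simp: in_keys_iff)

lemma push_zero [simp]: "push g 0 = 0"
  by (simp add: push_def)

lemma push_single [simp]: "push g (Poly_Mapping.single v x) = Poly_Mapping.single (g v) x"
  by (cases "x = 0") (simp_all add: push_def)

lemma push_add: "push g (p + q) = push g p + push g q"
proof -
  let ?A = "Poly_Mapping.keys p \<union> Poly_Mapping.keys q"
  have "push g (p + q) = (\<Sum>v\<in>?A. Poly_Mapping.single (g v) (Poly_Mapping.lookup (p + q) v))"
    by (rule push_superset) (simp_all add: Poly_Mapping.keys_add)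
  also have "\<dots> = push g p + push g q"
    by (simp add: push_superset[of ?A] lookup_add single_add sum.distrib)
  finally show ?thesis .
qed

lemma push_diff: "push g (p - q) = push g p - push g q"
  for p q :: "'a \<Rightarrow>\<^sub>0 'c::ab_group_add"
  using push_add[of g "p - q" q] by (simp add: algebra_simps)

lemma push_mult:
  fixes p q :: "'a::monoid_add \<Rightarrow>\<^sub>0 'c::semiring_0"
  assumes "\<And>s t. g (s + t) = g s + g t"
  shows "push g (p * q) = push g p * push g q"
proof (induction p rule: poly_mapping_term_induct)
  case (single t x)
  show ?case
    by (induction q rule: poly_mapping_term_induct)
      (simp_all add: distrib_left push_add mult_single assms)
qed (simp_all add: distrib_right push_add)

lemma keys_push_nat: "Poly_Mapping.keys (push g p) = g ` Poly_Mapping.keys p"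
  for p :: "'a \<Rightarrow>\<^sub>0 nat"
proof (induction p rule: poly_mapping_term_induct)
  case (single t x)
  then show ?case by (cases "x = 0") simp_all
qed (auto simp: push_add keys_add_nat)

text \<open>
  The total degree is what remains of an exponent vector when all variables are identified; additivity
  of the degree is thus an instance of \<open>push_add\<close>.
\<close>
lemma deg_monom_push: "Poly_Mapping.single () (deg_monom t) = push (\<lambda>_. ()) t"
  unfolding deg_monom_def push_def
  by (rule poly_mapping_eqI) (simp add: lookup_sum)

lemma deg_monom_add: "deg_monom (s + t) = deg_monom s + deg_monom t"
  using deg_monom_push[of "s + t"] deg_monom_push[of s] deg_monom_push[of t]
  by (metis push_add single_add lookup_single_eq)

lemma deg_monom_single [simp]: "deg_monom (Poly_Mapping.single v k) = k"
  by (cases "k = 0") (simp_all add: deg_monom_def)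

lemma deg_monom_zero [simp]: "deg_monom 0 = 0"
  by (simp add: deg_monom_def)

lemma deg_monom_eq_0_iff: "deg_monom t = 0 \<longleftrightarrow> t = 0"
  by (auto simp: deg_monom_def in_keys_iff intro: poly_mapping_eqI)

section \<open>The polynomial rings and their graded pieces\<close>

lemma poly_ring_ops [simp]:
  "monoid.mult (poly_ring m) = (*)" "monoid.one (poly_ring m) = 1"
  "ring.add (poly_ring m) = (+)" "ring.zero (poly_ring m) = 0"
  by (simp_all add: poly_ring_def)

lemma in_poly_ring_iff:
  "p \<in> carrier (poly_ring m) \<longleftrightarrow> (\<forall>t\<in>Poly_Mapping.keys p. Poly_Mapping.keys t \<subseteq> vars m)"
  by (simp add: poly_ring_def)

lemma ring_poly_ring: "ring (poly_ring m :: 'k::comm_ring_1 pol ring)"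
  using cring_poly_ring cring.axioms(1) by blast

lemma poly_ring_0 [simp]: "0 \<in> carrier (poly_ring m)"
  and poly_ring_1 [simp]: "1 \<in> carrier (poly_ring m)"
  by (simp_all add: in_poly_ring_iff)

lemma poly_ring_add [intro]:
  "p \<in> carrier (poly_ring m) \<Longrightarrow> q \<in> carrier (poly_ring m) \<Longrightarrow> p + q \<in> carrier (poly_ring m)"
  using ring.ring_simprules(1)[OF ring_poly_ring, of p m q] by simp

lemma poly_ring_mult [intro]:
  "p \<in> carrier (poly_ring m) \<Longrightarrow> q \<in> carrier (poly_ring m) \<Longrightarrow> p * q \<in> carrier (poly_ring m)"
  using ring.ring_simprules(5)[OF ring_poly_ring, of p m q] by simp

lemma poly_ring_uminus [intro]: "p \<in> carrier (poly_ring m) \<Longrightarrow> - p \<in> carrier (poly_ring m)"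
  by (simp add: in_poly_ring_iff)

lemma poly_ring_sum [intro]:
  "(\<And>i. i \<in> A \<Longrightarrow> p i \<in> carrier (poly_ring m)) \<Longrightarrow> sum p A \<in> carrier (poly_ring m)"
  by (induction A rule: infinite_finite_induct) auto

lemma poly_ring_single:
  "Poly_Mapping.keys t \<subseteq> vars m \<Longrightarrow> Poly_Mapping.single t x \<in> carrier (poly_ring m)"
  by (simp add: in_poly_ring_iff)

lemma ideal_poly_ringD:
  assumes "ideal I (poly_ring m)"
  shows ideal_poly_subset: "I \<subseteq> carrier (poly_ring m)"
    and ideal_poly_0: "0 \<in> I"
    and ideal_poly_add: "\<And>p q. p \<in> I \<Longrightarrow> q \<in> I \<Longrightarrow> p + q \<in> I"
    and ideal_poly_mult: "\<And>p q. p \<in> carrier (poly_ring m) \<Longrightarrow> q \<in> I \<Longrightarrow> p * q \<in> I"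
    and ideal_poly_diff: "\<And>p q. p \<in> I \<Longrightarrow> q \<in> I \<Longrightarrow> p - q \<in> I"
    and ideal_poly_sum: "\<And>A p. (\<And>i. i \<in> A \<Longrightarrow> p i \<in> I) \<Longrightarrow> sum p A \<in> I"
proof -
  interpret ideal I "poly_ring m" by fact
  show "I \<subseteq> carrier (poly_ring m)" using a_subset .
  show zero: "0 \<in> I" using additive_subgroup.zero_closed[OF is_additive_subgroup] by simp
  show add: "p + q \<in> I" if "p \<in> I" "q \<in> I" for p q
    using additive_subgroup.a_closed[OF is_additive_subgroup that] by simp
  show mult: "p * q \<in> I" if "p \<in> carrier (poly_ring m)" "q \<in> I" for p q
    using I_l_closed[OF that(2,1)] by simp
  show "p - q \<in> I" if "p \<in> I" "q \<in> I" for p q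
    using add[OF that(1) mult[OF poly_ring_uminus[OF poly_ring_1] that(2)]] by simp
  show "sum p A \<in> I" if "\<And>i. i \<in> A \<Longrightarrow> p i \<in> I" for A and p :: "'c \<Rightarrow> _"
    using that by (induction A rule: infinite_finite_induct) (auto simp: zero add)
qed

lemma ideal_poly_ringI:
  assumes "I \<subseteq> carrier (poly_ring m)" "0 \<in> I" "\<And>p q. p \<in> I \<Longrightarrow> q \<in> I \<Longrightarrow> p + q \<in> I"
    "\<And>p q. p \<in> carrier (poly_ring m) \<Longrightarrow> q \<in> I \<Longrightarrow> p * q \<in> I"
  shows "ideal I (poly_ring m)"
proof (rule idealI)
  show "subgroup I (add_monoid (poly_ring m))"
  proof (rule group.subgroupI)
    show "group (add_monoid (poly_ring m))"
      using ring_poly_ring abelian_group.a_group ring.is_abelian_group by blast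
    fix p assume p: "p \<in> I"
    then have pc: "p \<in> carrier (poly_ring m)" using assms by auto
    interpret ring "poly_ring m" by (rule ring_poly_ring)
    have "\<ominus>\<^bsub>poly_ring m\<^esub> p = - p"
      using r_neg[OF pc] by (simp add: add_eq_0_iff)
    then show "inv\<^bsub>add_monoid (poly_ring m)\<^esub> p \<in> I"
      using assms(4)[OF poly_ring_uminus[OF poly_ring_1] p] by (simp add: a_inv_def)
  qed (use assms in auto)
  show "x \<otimes>\<^bsub>poly_ring m\<^esub> a \<in> I" "a \<otimes>\<^bsub>poly_ring m\<^esub> x \<in> I"
    if "a \<in> I" "x \<in> carrier (poly_ring m)" for a x
    using assms(4)[OF that(2,1)] by (simp_all add: mult.commute)
qed (rule ring_poly_ring)

lemma graded_piece_subset: "p \<in> graded_piece m d \<Longrightarrow> p \<in> carrier (poly_ring m)"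
  by (simp add: graded_piece_def)

lemma graded_piece_0 [simp]: "0 \<in> graded_piece m d"
  and graded_piece_1 [simp]: "1 \<in> graded_piece m 0"
  by (simp_all add: graded_piece_def)

lemma graded_piece_add [intro]:
  "p \<in> graded_piece m d \<Longrightarrow> q \<in> graded_piece m d \<Longrightarrow> p + q \<in> graded_piece m d"
  using Poly_Mapping.keys_add[of p q] by (auto simp: graded_piece_def)

lemma graded_piece_uminus [intro]: "p \<in> graded_piece m d \<Longrightarrow> - p \<in> graded_piece m d"
  by (auto simp: graded_piece_def)

lemma graded_piece_diff [intro]:
  "p \<in> graded_piece m d \<Longrightarrow> q \<in> graded_piece m d \<Longrightarrow> p - q \<in> graded_piece m d"
  using graded_piece_add[OF _ graded_piece_uminus, of p m d q] by simp

lemma graded_piece_sum [intro]: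
  "(\<And>i. i \<in> A \<Longrightarrow> p i \<in> graded_piece m d) \<Longrightarrow> sum p A \<in> graded_piece m d"
  by (induction A rule: infinite_finite_induct) auto

lemma graded_piece_mult [intro]:
  assumes "p \<in> graded_piece m c" "q \<in> graded_piece m d"
  shows "p * q \<in> graded_piece m (c + d)"
  using assms Poly_Mapping.keys_mult[of p q]
  by (fastforce simp: graded_piece_def deg_monom_add)

subsection \<open>Homogeneous components\<close>

definition hcomp :: "int \<Rightarrow> 'k::comm_ring_1 pol \<Rightarrow> 'k pol" where
  "hcomp d p = (\<Sum>t\<in>{t\<in>Poly_Mapping.keys p. int (deg_monom t) = d}.
      Poly_Mapping.single t (Poly_Mapping.lookup p t))"

lemma lookup_hcomp:
  "Poly_Mapping.lookup (hcomp d p) t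
    = (if int (deg_monom t) = d then Poly_Mapping.lookup p t else 0)"
  by (auto simp: hcomp_def lookup_sum lookup_single when_def in_keys_iff)

lemma hcomp_in_graded_piece:
  "p \<in> carrier (poly_ring m) \<Longrightarrow> hcomp d p \<in> graded_piece m d"
  by (auto simp: graded_piece_def in_poly_ring_iff in_keys_iff lookup_hcomp split: if_splits)

lemma hcomp_0 [simp]: "hcomp d 0 = 0"
  by (simp add: hcomp_def)

lemma hcomp_add: "hcomp d (p + q) = hcomp d p + hcomp d q"
  by (rule poly_mapping_eqI) (simp add: lookup_hcomp lookup_add)

lemma hcomp_diff: "hcomp d (p - q) = hcomp d p - hcomp d q"
  by (rule poly_mapping_eqI) (simp add: lookup_hcomp lookup_minus)

lemma hcomp_sum: "hcomp d (sum p A) = (\<Sum>i\<in>A. hcomp d (p i))"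
  by (induction A rule: infinite_finite_induct) (auto simp: hcomp_add)

lemma hcomp_eq_self: "p \<in> graded_piece m d \<Longrightarrow> hcomp d p = p"
  by (rule poly_mapping_eqI) (auto simp: lookup_hcomp graded_piece_def in_keys_iff)

text \<open>
  Multiplication by a form shifts homogeneous components. This is what allows solutions of
  homogeneous linear equations to be replaced by homogeneous solutions.
\<close>
lemma hcomp_mult:
  assumes "g \<in> graded_piece m c"
  shows "hcomp d (g * p) = g * hcomp (d - c) p"
proof -
  have single: "hcomp d (Poly_Mapping.single s x * p) = Poly_Mapping.single s x * hcomp (d - c) p"
    if "int (deg_monom s) = c" for s x
  proof (induction p rule: poly_mapping_term_induct)
    case (single t y)
    have "hcomp d' (Poly_Mapping.single u z) =
      (if int (deg_monom u) = d' then Poly_Mapping.single u z else 0)" for d' u and z :: 'a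
      by (rule poly_mapping_eqI) (auto simp: lookup_hcomp lookup_single when_def)
    then show ?case using that by (auto simp: mult_single deg_monom_add)
  qed (simp_all add: distrib_left hcomp_add)
  have "hcomp d (g * p) = hcomp d ((\<Sum>t\<in>Poly_Mapping.keys g.
      Poly_Mapping.single t (Poly_Mapping.lookup g t)) * p)"
    by (simp add: sum_single_lookup)
  also have "\<dots> = (\<Sum>t\<in>Poly_Mapping.keys g.
      Poly_Mapping.single t (Poly_Mapping.lookup g t)) * hcomp (d - c) p"
    using assms by (simp add: sum_distrib_right hcomp_sum single graded_piece_def)
  also have "\<dots> = g * hcomp (d - c) p" by (simp add: sum_single_lookup)
  finally show ?thesis .
qed

section \<open>The ideals \<open>P\<^sub>\<emptyset>(G)\<close> are prime\<close>

lemma f_pol_single: "f_pol i j = Poly_Mapping.single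
    (Poly_Mapping.single (Xvar i) 1 + Poly_Mapping.single (Yvar j) 1) 1
  - Poly_Mapping.single (Poly_Mapping.single (Xvar j) 1 + Poly_Mapping.single (Yvar i) 1) 1"
  by (simp add: f_pol_def var_pol_def mult_single)

lemma f_pol_graded:
  assumes "i \<in> {1..m}" "j \<in> {1..m}" shows "f_pol i j \<in> graded_piece m 2"
  unfolding f_pol_single using assms
  by (intro graded_piece_diff)
    (auto simp: graded_piece_def in_poly_ring_iff vars_def keys_add_nat deg_monom_add)

lemma f_pol_carrier:
  "i \<in> {1..m} \<Longrightarrow> j \<in> {1..m} \<Longrightarrow> f_pol i j \<in> carrier (poly_ring m)"
  using f_pol_graded graded_piece_subset by blast

text \<open>
  The substitution \<open>x\<^sub>i \<mapsto> a\<^sub>i s\<^bsub>c i\<^esub>\<close>, \<open>y\<^sub>i \<mapsto> a\<^sub>i t\<^bsub>c i\<^esub>\<close> for a function \<open>c\<close> that labels the blocks of a partition of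
  the indices. The target variables \<open>a\<^sub>j, s\<^sub>j, t\<^sub>j\<close> are coded as the natural numbers
  \<open>3 j, 3 j + 1, 3 j + 2\<close>: with a linearly ordered set of variables, the target polynomial ring is an
  instance of \<^class>\<open>idom\<close>. On monomials the substitution is the product of the images of all
  \<open>a\<close>-parts (\<open>row_label\<close>) and of all \<open>s\<close>- and \<open>t\<close>-parts (\<open>col_label\<close>).
\<close>
fun row_label :: "var \<Rightarrow> nat" where
  "row_label (Xvar i) = 3 * i"
| "row_label (Yvar i) = 3 * i"

fun col_label :: "(nat \<Rightarrow> nat) \<Rightarrow> var \<Rightarrow> nat" where
  "col_label c (Xvar i) = 3 * c i + 1"
| "col_label c (Yvar i) = 3 * c i + 2"

definition toric_monom :: "(nat \<Rightarrow> nat) \<Rightarrow> monom \<Rightarrow> (nat \<Rightarrow>\<^sub>0 nat)" where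
  "toric_monom c t = push row_label t + push (col_label c) t"

definition toric_map :: "(nat \<Rightarrow> nat) \<Rightarrow> 'k::comm_ring_1 pol \<Rightarrow> ((nat \<Rightarrow>\<^sub>0 nat) \<Rightarrow>\<^sub>0 'k)" where
  "toric_map c = push (toric_monom c)"

lemma toric_monom_add: "toric_monom c (s + t) = toric_monom c s + toric_monom c t"
  by (simp add: toric_monom_def push_add ac_simps)

lemma toric_map_mult: "toric_map c (p * q) = toric_map c p * toric_map c q"
  unfolding toric_map_def by (rule push_mult) (rule toric_monom_add)

lemma keys_toric_monom: "Poly_Mapping.keys (toric_monom c t)
    = row_label ` Poly_Mapping.keys t \<union> col_label c ` Poly_Mapping.keys t"
  by (simp add: toric_monom_def keys_add_nat keys_push_nat)

text \<open>
  The two terms of \<open>f\<^sub>i\<^sub>j\<close> go to \<open>a\<^sub>i a\<^sub>j s\<^bsub>c i\<^esub> t\<^bsub>c j\<^esub>\<close> and \<open>a\<^sub>i a\<^sub>j s\<^bsub>c j\<^esub> t\<^bsub>c i\<^esub>\<close>, which agree only for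
  \<open>c i = c j\<close>.
\<close>
lemma toric_map_f_pol:
  assumes "i \<noteq> j"
  shows "toric_map c (f_pol i j :: 'k::comm_ring_1 pol) = 0 \<longleftrightarrow> c i = c j"
proof -
  let ?s = "\<lambda>i j. toric_monom c (Poly_Mapping.single (Xvar i) 1 + Poly_Mapping.single (Yvar j) 1)"
  have eq: "toric_map c (f_pol i j :: 'k pol) =
    Poly_Mapping.single (?s i j) 1 - Poly_Mapping.single (?s j i) 1"
    unfolding f_pol_single toric_map_def by (simp only: push_diff push_single)
  have "?s i j = ?s j i" if "c i = c j"
    using that by (simp add: toric_monom_def push_add ac_simps)
  moreover have "Poly_Mapping.keys (?s i j) \<noteq> Poly_Mapping.keys (?s j i)" if "c i \<noteq> c j"
  proof -
    have "3 * c i + 1 \<in> Poly_Mapping.keys (?s i j)"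
      by (simp add: keys_toric_monom keys_add_nat)
    moreover have "3 * c i + 1 \<notin> Poly_Mapping.keys (?s j i)"
      using that by (simp add: keys_toric_monom keys_add_nat) presburger
    ultimately show ?thesis by metis
  qed
  ultimately have iff: "?s i j = ?s j i \<longleftrightarrow> c i = c j" by metis
  have "toric_map c (f_pol i j :: 'k pol) = 0 \<longleftrightarrow> ?s i j = ?s j i"
  proof
    assume "toric_map c (f_pol i j :: 'k pol) = 0"
    then have "Poly_Mapping.keys (Poly_Mapping.single (?s i j) (1::'k))
      = Poly_Mapping.keys (Poly_Mapping.single (?s j i) (1::'k))"
      by (simp only: eq right_minus_eq)
    then show "?s i j = ?s j i" by simp
  qed (simp only: eq diff_self)
  then show ?thesis using iff by simp
qed

definition block_ideal :: "nat \<Rightarrow> (nat \<Rightarrow> nat) \<Rightarrow> 'k::comm_ring_1 pol set" where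
  "block_ideal m c = genideal (poly_ring m)
     {f_pol i j | i j. i \<in> {1..m} \<and> j \<in> {1..m} \<and> i < j \<and> c i = c j}"

lemma block_gens_subset:
  "{f_pol i j | i j. i \<in> {1..m} \<and> j \<in> {1..m} \<and> i < j \<and> c i = c j} \<subseteq> carrier (poly_ring m)"
  using f_pol_carrier by blast

lemma ideal_block_ideal: "ideal (block_ideal m c) (poly_ring m)"
  unfolding block_ideal_def using ring.genideal_ideal[OF ring_poly_ring block_gens_subset] .

lemma f_pol_in_block_ideal:
  assumes ij: "i \<in> {1..m}" "j \<in> {1..m}" and "c i = c j"
  shows "(f_pol i j :: 'k::comm_ring_1 pol) \<in> block_ideal m c"
proof -
  have less: "(f_pol i j :: 'k pol) \<in> block_ideal m c"
    if "i < j" "i \<in> {1..m}" "j \<in> {1..m}" "c i = c j" for i j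
    unfolding block_ideal_def
    using that by (intro subsetD[OF ring.genideal_self[OF ring_poly_ring block_gens_subset]]) blast
  consider "i < j" | "i = j" | "j < i" by linarith
  then show ?thesis
  proof cases
    case 3
    then have "0 - (f_pol j i :: 'k pol) \<in> block_ideal m c"
      using less[of j i] assms by (intro ideal_poly_diff[OF ideal_block_ideal]
        ideal_poly_0[OF ideal_block_ideal]) auto
    then show ?thesis by (simp add: f_pol_def)
  qed (use less assms ideal_poly_0[OF ideal_block_ideal] in \<open>auto simp: f_pol_def\<close>)
qed

lemma in_keys_decompose:
  fixes t :: monom
  assumes "v \<in> Poly_Mapping.keys t"
  shows "t = (t - Poly_Mapping.single v 1) + Poly_Mapping.single v 1"
  using assms
  by (intro poly_mapping_eqI) (auto simp: lookup_add lookup_minus lookup_single when_def in_keys_iff)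

lemma exchange_in_block_ideal:
  assumes "i \<in> {1..m}" "j \<in> {1..m}" "c i = c j" "Poly_Mapping.keys s \<subseteq> vars m"
  shows "Poly_Mapping.single (s + (Poly_Mapping.single (Xvar i) 1 + Poly_Mapping.single (Yvar j) 1)) 1
    - Poly_Mapping.single (s + (Poly_Mapping.single (Xvar j) 1 + Poly_Mapping.single (Yvar i) 1)) 1
    \<in> (block_ideal m c :: 'k::comm_ring_1 pol set)"
proof -
  have "Poly_Mapping.single s 1 * f_pol i j \<in> (block_ideal m c :: 'k pol set)"
    using assms
    by (intro ideal_poly_mult[OF ideal_block_ideal] poly_ring_single f_pol_in_block_ideal)
  then show ?thesis by (simp add: f_pol_single right_diff_distrib mult_single)
qed

text \<open>
  One exchange step inside a fibre. Let \<open>x\<^sub>i\<close> divide \<open>s\<close> but not \<open>t\<close>. The factor \<open>a\<^sub>i\<close> of the common image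
  must come from \<open>y\<^sub>i\<close> dividing \<open>t\<close>, and the factor \<open>s\<^bsub>c i\<^esub>\<close> from some \<open>x\<^sub>j\<close> dividing \<open>t\<close> with
  \<open>c j = c i\<close>. Replacing \<open>x\<^sub>j y\<^sub>i\<close> by \<open>x\<^sub>i y\<^sub>j\<close> changes \<open>t\<close> by a multiple of a generator and makes it
  divisible by \<open>x\<^sub>i\<close>. The case of \<open>y\<^sub>i\<close> is symmetric.
\<close>
lemma toric_fibre_share:
  assumes "toric_monom c s = toric_monom c t"
    and v: "v \<in> Poly_Mapping.keys s" and s: "Poly_Mapping.keys s \<subseteq> vars m"
    and t: "Poly_Mapping.keys t \<subseteq> vars m"
  shows "\<exists>t'. v \<in> Poly_Mapping.keys t' \<and> Poly_Mapping.keys t' \<subseteq> vars m \<and>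
    toric_monom c t' = toric_monom c t \<and>
    Poly_Mapping.single t 1 - Poly_Mapping.single t' 1 \<in> (block_ideal m c :: 'k::comm_ring_1 pol set)"
proof (cases "v \<in> Poly_Mapping.keys t")
  case True
  then show ?thesis using t ideal_poly_0[OF ideal_block_ideal] by (intro exI[of _ t]) auto
next
  case False
  have "row_label v \<in> Poly_Mapping.keys (toric_monom c t)"
    "col_label c v \<in> Poly_Mapping.keys (toric_monom c t)"
    using v unfolding assms(1)[symmetric] by (auto simp: keys_toric_monom)
  then obtain u w where u: "u \<in> Poly_Mapping.keys t" "row_label u = row_label v \<or> col_label c u = row_label v"
    and w: "w \<in> Poly_Mapping.keys t" "row_label w = col_label c v \<or> col_label c w = col_label c v"
    by (auto simp: keys_toric_monom)
  define r where "r = t - Poly_Mapping.single u 1 - Poly_Mapping.single w 1"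
  have split: "t = r + (Poly_Mapping.single w 1 + Poly_Mapping.single u 1)" if "u \<noteq> w"
    unfolding r_def using u(1) w(1) that
    by (intro poly_mapping_eqI) (auto simp: lookup_add lookup_minus lookup_single when_def in_keys_iff)
  show ?thesis
  proof (cases v)
    case (Xvar i)
    have ui: "u = Yvar i" using u Xvar False by (cases u) (auto, presburger+)
    obtain j where wj: "w = Xvar j" "c j = c i" using w Xvar by (cases w) (auto, presburger+)
    let ?t = "r + (Poly_Mapping.single (Xvar i) 1 + Poly_Mapping.single (Yvar j) 1)"
    have teq: "t = r + (Poly_Mapping.single (Xvar j) 1 + Poly_Mapping.single (Yvar i) 1)"
      using split ui wj by simp
    have "Poly_Mapping.keys r \<subseteq> vars m" "i \<in> {1..m}" "j \<in> {1..m}"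
      using t unfolding teq by (auto simp: keys_add_nat vars_def)
    moreover have "toric_monom c ?t = toric_monom c t"
      unfolding teq toric_monom_add by (simp add: toric_monom_def wj ac_simps)
    moreover have "Poly_Mapping.single t 1 - Poly_Mapping.single ?t 1
      \<in> (block_ideal m c :: 'k pol set)"
      unfolding teq using calculation wj by (intro exchange_in_block_ideal) auto
    ultimately show ?thesis
      by (intro exI[of _ ?t]) (auto simp: Xvar keys_add_nat vars_def)
  next
    case (Yvar i)
    have ui: "u = Xvar i" using u Yvar False by (cases u) (auto, presburger+)
    obtain j where wj: "w = Yvar j" "c j = c i" using w Yvar by (cases w) (auto, presburger+)
    let ?t = "r + (Poly_Mapping.single (Xvar j) 1 + Poly_Mapping.single (Yvar i) 1)"
    have teq: "t = r + (Poly_Mapping.single (Xvar i) 1 + Poly_Mapping.single (Yvar j) 1)"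
      using split ui wj by (simp add: ac_simps)
    have "Poly_Mapping.keys r \<subseteq> vars m" "i \<in> {1..m}" "j \<in> {1..m}"
      using t unfolding teq by (auto simp: keys_add_nat vars_def)
    moreover have "toric_monom c ?t = toric_monom c t"
      unfolding teq toric_monom_add by (simp add: toric_monom_def wj ac_simps)
    moreover have "Poly_Mapping.single t 1 - Poly_Mapping.single ?t 1
      \<in> (block_ideal m c :: 'k pol set)"
      unfolding teq using calculation wj by (intro exchange_in_block_ideal) auto
    ultimately show ?thesis
      by (intro exI[of _ ?t]) (auto simp: Yvar keys_add_nat vars_def)
  qed
qed

text \<open>
  Induction on the degree: after an exchange step both monomials share a variable, which can be
  cancelled.
\<close>
lemma toric_fibre_congruent:
  assumes "toric_monom c s = toric_monom c t"
    and "Poly_Mapping.keys s \<subseteq> vars m" and "Poly_Mapping.keys t \<subseteq> vars m"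
  shows "Poly_Mapping.single s 1 - Poly_Mapping.single t 1 \<in> (block_ideal m c :: 'k::comm_ring_1 pol set)"
  using assms
proof (induction "deg_monom s" arbitrary: s t)
  case 0
  then have "s = 0" by (simp add: deg_monom_eq_0_iff)
  then have "Poly_Mapping.keys (toric_monom c t) = {}" using 0(2) by (simp add: toric_monom_def)
  then have "t = 0" by (simp add: keys_toric_monom)
  then show ?case using \<open>s = 0\<close> ideal_poly_0[OF ideal_block_ideal] by simp
next
  case (Suc n)
  then obtain v where v: "v \<in> Poly_Mapping.keys s"
    using deg_monom_eq_0_iff[of s] by fastforce
  obtain t' where t': "v \<in> Poly_Mapping.keys t'" "Poly_Mapping.keys t' \<subseteq> vars m"
    "toric_monom c t' = toric_monom c t"
    "Poly_Mapping.single t 1 - Poly_Mapping.single t' 1 \<in> (block_ideal m c :: 'k pol set)"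
    using toric_fibre_share[OF Suc.prems(1) v Suc.prems(2,3)] by blast
  define s1 t1 where "s1 = s - Poly_Mapping.single v 1" and "t1 = t' - Poly_Mapping.single v 1"
  have s1: "s = s1 + Poly_Mapping.single v 1" and t1: "t' = t1 + Poly_Mapping.single v 1"
    unfolding s1_def t1_def using v t'(1) by (simp_all only: in_keys_decompose[symmetric])
  have "Poly_Mapping.single s1 1 - Poly_Mapping.single t1 1 \<in> (block_ideal m c :: 'k pol set)"
  proof (rule Suc.hyps(1))
    show "n = deg_monom s1" using Suc.hyps(2) by (simp add: s1 deg_monom_add)
    have "toric_monom c s = toric_monom c t'" using Suc.prems(1) t'(3) by simp
    then show "toric_monom c s1 = toric_monom c t1" by (simp add: s1 t1 toric_monom_add)
  qed (use Suc.prems(2) t'(2) in \<open>auto simp: s1 t1 keys_add_nat\<close>)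
  then have "var_pol v * (Poly_Mapping.single s1 1 - Poly_Mapping.single t1 1) \<in> (block_ideal m c :: 'k pol set)"
    using v Suc.prems(2) unfolding var_pol_def
    by (intro ideal_poly_mult[OF ideal_block_ideal] poly_ring_single) auto
  then have "Poly_Mapping.single s 1 - Poly_Mapping.single t' 1 \<in> (block_ideal m c :: 'k pol set)"
    by (simp add: var_pol_def right_diff_distrib mult_single s1 t1 add.commute)
  from ideal_poly_diff[OF ideal_block_ideal this t'(4)] show ?case by simp
qed

lemma push_push: "push h (push g p) = push (h \<circ> g) p"
  by (induction p rule: poly_mapping_term_induct) (simp_all add: push_add)

text \<open>
  Choose one monomial in each fibre that meets the support of \<open>p\<close>. Moving every term of \<open>p\<close> to the chosen
  monomial of its fibre changes \<open>p\<close> by an element of the ideal, and leaves \<open>0\<close> because the coefficients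
  over each fibre add up to \<open>0\<close>.
\<close>
lemma toric_kernel_subset_block_ideal:
  fixes p :: "'k::comm_ring_1 pol"
  assumes p: "p \<in> carrier (poly_ring m)" and "toric_map c p = 0"
  shows "p \<in> block_ideal m c"
proof -
  \<comment> \<open>the chosen monomial in the fibre over \<open>u\<close>\<close>
  define rep where "rep u = (SOME t. t \<in> Poly_Mapping.keys p \<and> toric_monom c t = u)" for u
  have rep: "rep (toric_monom c t) \<in> Poly_Mapping.keys p \<and>
      toric_monom c (rep (toric_monom c t)) = toric_monom c t"
    if "t \<in> Poly_Mapping.keys p" for t
    unfolding rep_def by (rule someI[of _ t]) (use that in simp)
  have zero: "push (rep \<circ> toric_monom c) p = 0"
    using assms(2) by (simp add: toric_map_def flip: push_push)
  have "p = (\<Sum>t\<in>Poly_Mapping.keys p. Poly_Mapping.single t (Poly_Mapping.lookup p t))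
      - push (rep \<circ> toric_monom c) p"
    by (simp add: sum_single_lookup zero)
  also have "\<dots> = (\<Sum>t\<in>Poly_Mapping.keys p. Poly_Mapping.single 0 (Poly_Mapping.lookup p t) *
      (Poly_Mapping.single t 1 - Poly_Mapping.single (rep (toric_monom c t)) 1))"
    by (simp add: push_def right_diff_distrib mult_single sum_subtractf)
  also have "\<dots> \<in> block_ideal m c"
  proof (intro ideal_poly_sum[OF ideal_block_ideal] ideal_poly_mult[OF ideal_block_ideal]
      poly_ring_single toric_fibre_congruent)
    fix t assume t: "t \<in> Poly_Mapping.keys p"
    show "toric_monom c t = toric_monom c (rep (toric_monom c t))"
      "Poly_Mapping.keys t \<subseteq> vars m" "Poly_Mapping.keys (rep (toric_monom c t)) \<subseteq> vars m"
      using rep[OF t] t p by (auto simp: in_poly_ring_iff)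
  qed simp
  finally show ?thesis .
qed

lemma toric_map_add: "toric_map c (p + q) = toric_map c p + toric_map c q"
  unfolding toric_map_def by (rule push_add)

lemma block_ideal_eq_toric_kernel:
  "block_ideal m c = {p \<in> carrier (poly_ring m). toric_map c p = 0}" (is "_ = ?ker")
proof
  have "ideal ?ker (poly_ring m)"
  proof (rule ideal_poly_ringI)
    show "0 \<in> ?ker" by (simp add: toric_map_def)
  qed (auto simp: toric_map_mult toric_map_add)
  moreover have "{f_pol i j | i j. i \<in> {1..m} \<and> j \<in> {1..m} \<and> i < j \<and> c i = c j} \<subseteq> ?ker"
    by (clarsimp simp: toric_map_f_pol f_pol_carrier)
  ultimately show "block_ideal m c \<subseteq> ?ker"
    unfolding block_ideal_def by (intro ring.genideal_minimal[OF ring_poly_ring])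
qed (clarsimp simp: toric_kernel_subset_block_ideal)

lemma primeideal_block_ideal:
  "primeideal (block_ideal m c) (poly_ring m :: 'k::idom pol ring)"
proof (rule primeidealI[OF ideal_block_ideal cring_poly_ring])
  have "toric_map c (Poly_Mapping.single 0 (1::'k)) = Poly_Mapping.single (toric_monom c 0) 1"
    unfolding toric_map_def by (rule push_single)
  then have "toric_map c (1 :: 'k pol) = 1"
    by (simp add: toric_monom_def)
  then have "(1 :: 'k pol) \<notin> block_ideal m c"
    by (simp add: block_ideal_eq_toric_kernel)
  moreover have "(1 :: 'k pol) \<in> carrier (poly_ring m)" by simp
  ultimately show "carrier (poly_ring m) \<noteq> (block_ideal m c :: 'k pol set)" by metis
  fix p q :: "'k pol"
  assume "p \<in> carrier (poly_ring m)" "q \<in> carrier (poly_ring m)"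
    "p \<otimes>\<^bsub>poly_ring m\<^esub> q \<in> block_ideal m c"
  then show "p \<in> block_ideal m c \<or> q \<in> block_ideal m c"
    by (simp add: block_ideal_eq_toric_kernel toric_map_mult)
qed

lemma f_pol_in_block_ideal_iff:
  assumes "i \<in> {1..m}" "j \<in> {1..m}" "i \<noteq> j"
  shows "(f_pol i j :: 'k::comm_ring_1 pol) \<in> block_ideal m c \<longleftrightarrow> c i = c j"
  using assms by (simp add: block_ideal_eq_toric_kernel toric_map_f_pol f_pol_carrier)

text \<open>
  A graph enters only through its connected components, each labelled by its least vertex.
\<close>
lemma P_empty_eq_block_ideal:
  "P_empty m E = block_ideal m (\<lambda>i. LEAST k. connected_in E i k)"
  and component_label_eq_iff:
  "(LEAST k. connected_in E i k) = (LEAST k. connected_in E j k) \<longleftrightarrow> connected_in E i j"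
proof -
  have sym: "connected_in E i j" if "connected_in E j i" for i j
    using that symD[OF sym_rtrancl, of "{(u, v). {u, v} \<in> E}" j i]
    by (simp add: connected_in_def sym_def insert_commute)
  have trans: "connected_in E i k" if "connected_in E i j" "connected_in E j k" for i j k
    using that rtrancl_trans by (auto simp: connected_in_def)
  have least: "connected_in E i (LEAST k. connected_in E i k)" for i
    by (rule LeastI[of _ i]) (simp add: connected_in_def)
  show iff: "(LEAST k. connected_in E i k) = (LEAST k. connected_in E j k) \<longleftrightarrow> connected_in E i j" for i j
  proof
    assume ij: "connected_in E i j"
    have "connected_in E i k \<longleftrightarrow> connected_in E j k" for k
      using trans[OF sym[OF ij], of k] trans[OF ij, of k] by (rule iffI)
    then show "(LEAST k. connected_in E i k) = (LEAST k. connected_in E j k)" by simp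
  next
    assume "(LEAST k. connected_in E i k) = (LEAST k. connected_in E j k)"
    then have "connected_in E i (LEAST k. connected_in E j k)" using least[of i] by simp
    then show "connected_in E i j" by (rule trans[OF _ sym[OF least]])
  qed
  show "P_empty m E = block_ideal m (\<lambda>i. LEAST k. connected_in E i k)"
    unfolding P_empty_def block_ideal_def iff ..
qed

theorem primeideal_P_empty:
  "primeideal (P_empty m E) (poly_ring m :: 'k::idom pol ring)"
  unfolding P_empty_eq_block_ideal by (rule primeideal_block_ideal)

lemma f_pol_in_P_empty_iff:
  assumes "i \<in> {1..m}" "j \<in> {1..m}" "i \<noteq> j"
  shows "(f_pol i j :: 'k::comm_ring_1 pol) \<in> P_empty m E \<longleftrightarrow> connected_in E i j"
  unfolding P_empty_eq_block_ideal f_pol_in_block_ideal_iff[OF assms] component_label_eq_iff ..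

section \<open>Homogeneous maps between graded free modules\<close>

definition graded_maps :: "nat \<Rightarrow> int list \<Rightarrow> int list \<Rightarrow> 'k::comm_ring_1 pol mat set" where
  "graded_maps m a b = {M \<in> carrier_mat (length b) (length a).
     \<forall>k<length b. \<forall>l<length a. M $$ (k, l) \<in> graded_piece m (a ! l - b ! k)}"

lemma graded_maps_carrier_mat: "M \<in> graded_maps m a b \<Longrightarrow> M \<in> carrier_mat (length b) (length a)"
  and graded_maps_entry: "M \<in> graded_maps m a b \<Longrightarrow> k < length b \<Longrightarrow> l < length a \<Longrightarrow>
    M $$ (k, l) \<in> graded_piece m (a ! l - b ! k)"
  by (simp_all add: graded_maps_def)

lemma graded_maps_entry_carrier:
  "M \<in> graded_maps m a b \<Longrightarrow> k < length b \<Longrightarrow> l < length a \<Longrightarrow> M $$ (k, l) \<in> carrier (poly_ring m)"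
  using graded_maps_entry graded_piece_subset by blast

lemma mult_mat_entry:
  "A \<in> carrier_mat n k \<Longrightarrow> B \<in> carrier_mat k r \<Longrightarrow> i < n \<Longrightarrow> j < r \<Longrightarrow>
    (A * B) $$ (i, j) = (\<Sum>l<k. A $$ (i, l) * B $$ (l, j))"
  by (simp add: scalar_prod_def atLeast0LessThan)

lemma mult_mat_vec_entry:
  "A \<in> carrier_mat n k \<Longrightarrow> v \<in> carrier_vec k \<Longrightarrow> i < n \<Longrightarrow>
    (A *\<^sub>v v) $ i = (\<Sum>l<k. A $$ (i, l) * v $ l)"
  by (simp add: scalar_prod_def atLeast0LessThan)

lemma graded_maps_mult:
  assumes N: "N \<in> graded_maps m b c" and M: "M \<in> graded_maps m a b"
  shows "N * M \<in> graded_maps m a c"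
proof -
  note NM = graded_maps_carrier_mat[OF N] graded_maps_carrier_mat[OF M]
  have "(N * M) $$ (k, l) \<in> graded_piece m (a ! l - c ! k)" if "k < length c" "l < length a" for k l
  proof -
    have "N $$ (k, j) * M $$ (j, l) \<in> graded_piece m (a ! l - c ! k)" if "j < length b" for j
      using graded_piece_mult[OF graded_maps_entry[OF N, of k j] graded_maps_entry[OF M, of j l]]
        that \<open>k < length c\<close> \<open>l < length a\<close> by simp
    then show ?thesis
      unfolding mult_mat_entry[OF NM that] by (intro graded_piece_sum) simp
  qed
  then show ?thesis using NM by (simp add: graded_maps_def)
qed

lemma graded_maps_one: "1\<^sub>m (length a) \<in> graded_maps m a a"
  by (simp add: graded_maps_def)

lemma graded_maps_minus:
  "M \<in> graded_maps m a b \<Longrightarrow> N \<in> graded_maps m a b \<Longrightarrow> M - N \<in> graded_maps m a b"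
  by (auto simp: graded_maps_def intro!: graded_piece_diff)

lemma graded_maps_mult_vec:
  assumes M: "M \<in> graded_maps m a b" and v: "v \<in> free_module m (length a)"
  shows "M *\<^sub>v v \<in> free_module m (length b)"
proof -
  have vc: "v \<in> carrier_vec (length a)" using v by (simp add: free_module_def)
  have "(M *\<^sub>v v) $ k \<in> carrier (poly_ring m)" if "k < length b" for k
    unfolding mult_mat_vec_entry[OF graded_maps_carrier_mat[OF M] vc that]
    using graded_maps_entry_carrier[OF M that] v by (intro poly_ring_sum poly_ring_mult) (auto simp: free_module_def)
  then show ?thesis
    using graded_maps_carrier_mat[OF M] vc by (simp add: free_module_def)
qed

lemma graded_maps_col:
  assumes "M \<in> graded_maps m a b" "l < length a"
  shows "col M l \<in> free_module m (length b)"
  using graded_maps_carrier_mat[OF assms(1)] graded_maps_entry_carrier[OF assms(1) _ assms(2)] assms(2)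
  by (auto simp: free_module_def)

lemma unit_vec_free_module: "unit_vec r l \<in> free_module m r"
  by (auto simp: free_module_def unit_vec_def)

lemma col_eq_mult_unit_vec:
  fixes M :: "'a::comm_ring_1 mat"
  assumes "M \<in> carrier_mat r c" "l < c"
  shows "col M l = M *\<^sub>v unit_vec c l"
  using assms by (intro eq_vecI) simp_all

lemma mat_eq_0_if_cols:
  assumes "M \<in> carrier_mat r c" "\<And>l. l < c \<Longrightarrow> col M l = 0\<^sub>v r"
  shows "M = 0\<^sub>m r c"
proof (rule eq_matI)
  fix i j assume "i < dim_row (0\<^sub>m r c)" "j < dim_col (0\<^sub>m r c)"
  then have ij: "i < r" "j < c" by auto
  then have "col M j $ i = 0" using assms(2) by simp
  then show "M $$ (i, j) = 0\<^sub>m r c $$ (i, j)" using assms(1) ij by simp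
qed (use assms in auto)

text \<open>
  Columnwise preimages under \<open>D\<close> exist by hypothesis, but they need not be homogeneous. Their homogeneous
  components of the right degrees are preimages as well, since \<open>D\<close> and \<open>M\<close> are homogeneous.
\<close>
lemma homogeneous_factorization:
  assumes D: "D \<in> graded_maps m a b" and M: "M \<in> graded_maps m c b"
    and im: "\<And>l. l < length c \<Longrightarrow> col M l \<in> (\<lambda>w. D *\<^sub>v w) ` free_module m (length a)"
  shows "\<exists>N\<in>graded_maps m c a. D * N = M"
proof -
  note DM = graded_maps_carrier_mat[OF D] graded_maps_carrier_mat[OF M]
  have "\<forall>l. \<exists>w. l < length c \<longrightarrow> w \<in> free_module m (length a) \<and> col M l = D *\<^sub>v w"
    using im by blast
  then obtain w where w: "\<And>l. l < length c \<Longrightarrow> w l \<in> free_module m (length a)"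
    "\<And>l. l < length c \<Longrightarrow> col M l = D *\<^sub>v w l"
    by metis
  define N where "N = mat (length a) (length c) (\<lambda>(k, l). hcomp (c ! l - a ! k) (w l $ k))"
  have Nc: "N \<in> carrier_mat (length a) (length c)" by (simp add: N_def)
  have "N \<in> graded_maps m c a"
    unfolding graded_maps_def using w(1) Nc
    by (auto simp: N_def free_module_def intro!: hcomp_in_graded_piece)
  moreover have "D * N = M"
  proof (rule eq_matI)
    fix i l assume "i < dim_row M" "l < dim_col M"
    then have il: "i < length b" "l < length c" using DM by auto
    have "(D * N) $$ (i, l) = (\<Sum>k<length a. D $$ (i, k) * hcomp (c ! l - a ! k) (w l $ k))"
      unfolding mult_mat_entry[OF DM(1) Nc il] using il by (simp add: N_def)
    also have "\<dots> = (\<Sum>k<length a. hcomp (c ! l - b ! i) (D $$ (i, k) * w l $ k))"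
      using il by (intro sum.cong refl) (simp add: hcomp_mult[OF graded_maps_entry[OF D]])
    also have "\<dots> = hcomp (c ! l - b ! i) ((D *\<^sub>v w l) $ i)"
      using mult_mat_vec_entry[OF DM(1) _ il(1), of "w l"] w(1)[OF il(2)]
      by (simp add: free_module_def hcomp_sum)
    also have "(D *\<^sub>v w l) $ i = M $$ (i, l)"
      using w(2)[OF il(2)] il DM by (metis index_col carrier_matD)
    also have "hcomp (c ! l - b ! i) (M $$ (i, l)) = M $$ (i, l)"
      by (rule hcomp_eq_self[OF graded_maps_entry[OF M il]])
    finally show "(D * N) $$ (i, l) = M $$ (i, l)" .
  qed (use DM Nc in auto)
  ultimately show ?thesis by blast
qed

section \<open>Uniqueness of the shifts in a minimal resolution\<close>

lemma lookup_mult_0: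
  fixes p q :: "'k::comm_ring_1 pol"
  shows "Poly_Mapping.lookup (p * q) 0 = Poly_Mapping.lookup p 0 * Poly_Mapping.lookup q 0"
proof (induction p rule: poly_mapping_term_induct)
  case (single s x)
  show ?case
  proof (induction q rule: poly_mapping_term_induct)
    case (single t y)
    have "s + t = 0 \<longleftrightarrow> s = 0 \<and> t = 0"
      by (metis add_0 deg_monom_add deg_monom_eq_0_iff add_eq_0_iff_both_eq_0)
    then show ?case by (simp add: mult_single lookup_single when_def)
  qed (simp_all add: distrib_left lookup_add)
qed (simp_all add: distrib_right lookup_add)

lemma irrelevant_ideal_mult:
  "p \<in> carrier (poly_ring m) \<Longrightarrow> q \<in> irrelevant_ideal m \<Longrightarrow> p * q \<in> irrelevant_ideal m"
  by (auto simp: irrelevant_ideal_def lookup_mult_0)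

lemma irrelevant_ideal_sum:
  "(\<And>i. i \<in> A \<Longrightarrow> p i \<in> irrelevant_ideal m) \<Longrightarrow> sum p A \<in> irrelevant_ideal m"
  by (auto simp: irrelevant_ideal_def lookup_sum)

lemma elements_mat_mult_irrelevant:
  assumes M: "M \<in> graded_maps m b c" and N: "N \<in> graded_maps m a b"
    and "elements_mat M \<subseteq> irrelevant_ideal m \<or> elements_mat N \<subseteq> irrelevant_ideal m"
  shows "elements_mat (M * N) \<subseteq> irrelevant_ideal m"
proof
  fix x assume "x \<in> elements_mat (M * N)"
  note MN = graded_maps_carrier_mat[OF M] graded_maps_carrier_mat[OF N]
  from \<open>x \<in> _\<close> obtain i j where ij: "i < length c" "j < length a" "x = (M * N) $$ (i, j)"
    using MN by (force simp: elements_mat_def)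
  have "M $$ (i, l) * N $$ (l, j) \<in> irrelevant_ideal m" if l: "l < length b" for l
    using assms(3)
  proof
    assume "elements_mat M \<subseteq> irrelevant_ideal m"
    then have "M $$ (i, l) \<in> irrelevant_ideal m" using elements_matI[OF MN(1) ij(1) l refl] by blast
    then show ?thesis
      using irrelevant_ideal_mult[OF graded_maps_entry_carrier[OF N l ij(2)]] by (simp add: mult.commute)
  next
    assume "elements_mat N \<subseteq> irrelevant_ideal m"
    then have "N $$ (l, j) \<in> irrelevant_ideal m" using elements_matI[OF MN(2) l ij(2) refl] by blast
    then show ?thesis
      using irrelevant_ideal_mult[OF graded_maps_entry_carrier[OF M ij(1) l]] by simp
  qed
  then show "x \<in> irrelevant_ideal m"
    unfolding ij(3) mult_mat_entry[OF MN ij(1,2)] by (intro irrelevant_ideal_sum) simp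
qed

lemma graded_free_resolutionD:
  assumes "graded_free_resolution m I a e D"
  shows resolution_aug_carrier: "e \<in> carrier_vec (length (a 0))"
    and resolution_aug_graded: "\<And>k. k < length (a 0) \<Longrightarrow> e $ k \<in> graded_piece m (a 0 ! k)"
    and resolution_maps: "\<And>i. D i \<in> graded_maps m (a (Suc i)) (a i)"
    and resolution_aug_surj: "\<And>g. g \<in> carrier (poly_ring m) \<Longrightarrow>
      \<exists>v\<in>free_module m (length (a 0)). g - e \<bullet> v \<in> I"
    and resolution_exact_0: "{v \<in> free_module m (length (a 0)). e \<bullet> v \<in> I} =
      (\<lambda>w. D 0 *\<^sub>v w) ` free_module m (length (a 1))"
    and resolution_exact: "\<And>i. {v \<in> free_module m (length (a (Suc i))). D i *\<^sub>v v = 0\<^sub>v (length (a i))} =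
      (\<lambda>w. D (Suc i) *\<^sub>v w) ` free_module m (length (a (Suc (Suc i))))"
proof -
  let ?F = "\<lambda>i. free_module m (length (a i))"
  from assms obtain
    e: "e \<in> carrier_vec (length (a 0))" and
    eg: "\<forall>k<length (a 0). e $ k \<in> graded_piece m (a 0 ! k)" and
    D: "\<forall>i. D i \<in> carrier_mat (length (a i)) (length (a (Suc i))) \<and>
      (\<forall>k<length (a i). \<forall>l<length (a (Suc i)).
        D i $$ (k, l) \<in> graded_piece m (a (Suc i) ! l - a i ! k))" and
    surj: "\<forall>g\<in>carrier (poly_ring m). \<exists>v\<in>?F 0. g - e \<bullet> v \<in> I" and
    ex0: "{v \<in> ?F 0. e \<bullet> v \<in> I} = (\<lambda>w. D 0 *\<^sub>v w) ` ?F 1" and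
    ex: "\<forall>i. {v \<in> ?F (Suc i). D i *\<^sub>v v = 0\<^sub>v (length (a i))} = (\<lambda>w. D (Suc i) *\<^sub>v w) ` ?F (Suc (Suc i))"
    unfolding graded_free_resolution_def by (elim conjE)
  show "e \<in> carrier_vec (length (a 0))" by (fact e)
  show "e $ k \<in> graded_piece m (a 0 ! k)" if "k < length (a 0)" for k using eg that by simp
  show "D i \<in> graded_maps m (a (Suc i)) (a i)" for i using D by (simp add: graded_maps_def)
  show "\<exists>v\<in>?F 0. g - e \<bullet> v \<in> I" if "g \<in> carrier (poly_ring m)" for g
    by (rule bspec[OF surj that])
  show "{v \<in> ?F 0. e \<bullet> v \<in> I} = (\<lambda>w. D 0 *\<^sub>v w) ` ?F 1" by (fact ex0)
  show "{v \<in> ?F (Suc i). D i *\<^sub>v v = 0\<^sub>v (length (a i))} = (\<lambda>w. D (Suc i) *\<^sub>v w) ` ?F (Suc (Suc i))" for i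
    by (rule spec[OF ex])
qed

lemma resolution_complex:
  assumes "graded_free_resolution m I a e D"
  shows "D i * D (Suc i) = 0\<^sub>m (length (a i)) (length (a (Suc (Suc i))))"
proof (rule mat_eq_0_if_cols)
  note D = resolution_maps[OF assms, THEN graded_maps_carrier_mat]
  show "D i * D (Suc i) \<in> carrier_mat (length (a i)) (length (a (Suc (Suc i))))"
    by (rule mult_carrier_mat[OF D D])
  fix l assume l: "l < length (a (Suc (Suc i)))"
  have "col (D (Suc i)) l \<in> (\<lambda>w. D (Suc i) *\<^sub>v w) ` free_module m (length (a (Suc (Suc i))))"
    unfolding col_eq_mult_unit_vec[OF D l] using unit_vec_free_module by blast
  then have "D i *\<^sub>v col (D (Suc i)) l = 0\<^sub>v (length (a i))"
    using resolution_exact[OF assms, of i] by blast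
  then show "col (D i * D (Suc i)) l = 0\<^sub>v (length (a i))"
    by (simp only: col_mult2[OF D D l])
qed

lemma resolution_lift:
  assumes "graded_free_resolution m I a e D"
    and M: "M \<in> graded_maps m c (a (Suc i))" and "D i * M = 0\<^sub>m (length (a i)) (length c)"
  shows "\<exists>N\<in>graded_maps m c (a (Suc (Suc i))). D (Suc i) * N = M"
proof (rule homogeneous_factorization[OF resolution_maps[OF assms(1)] M])
  fix l assume l: "l < length c"
  have "D i *\<^sub>v col M l = col (D i * M) l"
    using col_mult2[OF graded_maps_carrier_mat[OF resolution_maps[OF assms(1)]] graded_maps_carrier_mat[OF M] l] ..
  also have "\<dots> = 0\<^sub>v (length (a i))" using assms(3) l by simp
  finally show "col M l \<in> (\<lambda>w. D (Suc i) *\<^sub>v w) ` free_module m (length (a (Suc (Suc i))))"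
    using resolution_exact[OF assms(1), of i] graded_maps_col[OF M l] by blast
qed

lemma resolution_lift_0:
  assumes "graded_free_resolution m I a e D"
    and M: "M \<in> graded_maps m c (a 0)" and "\<And>l. l < length c \<Longrightarrow> e \<bullet> col M l \<in> I"
  shows "\<exists>N\<in>graded_maps m c (a (Suc 0)). D 0 * N = M"
proof (rule homogeneous_factorization[OF resolution_maps[OF assms(1)] M])
  fix l assume l: "l < length c"
  then show "col M l \<in> (\<lambda>w. D 0 *\<^sub>v w) ` free_module m (length (a (Suc 0)))"
    using resolution_exact_0[OF assms(1)] graded_maps_col[OF M l] assms(3) by auto
qed

lemma scalar_prod_lessThan: "v \<in> carrier_vec n \<Longrightarrow> w \<bullet> v = (\<Sum>k<n. w $ k * v $ k)"
  by (simp add: scalar_prod_def atLeast0LessThan)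

text \<open>
  The start of a comparison map: the identity of \<open>S/I\<close> is covered by a homogeneous map between the
  modules in homological degree \<open>0\<close>. Passing to homogeneous components requires \<open>I\<close> to be homogeneous.
\<close>
lemma resolution_lift_identity:
  assumes I: "ideal I (poly_ring m)" and hom: "\<And>p d. p \<in> I \<Longrightarrow> hcomp d p \<in> I"
    and a: "graded_free_resolution m I a e D"
    and e': "e' \<in> carrier_vec (length b)" "\<And>l. l < length b \<Longrightarrow> e' $ l \<in> graded_piece m (b ! l)"
  shows "\<exists>\<phi>\<in>graded_maps m b (a 0). \<forall>v\<in>free_module m (length b). e' \<bullet> v - e \<bullet> (\<phi> *\<^sub>v v) \<in> I"
proof -
  have "\<forall>l. \<exists>w. l < length b \<longrightarrow> w \<in> free_module m (length (a 0)) \<and> e' $ l - e \<bullet> w \<in> I"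
    using resolution_aug_surj[OF a] graded_piece_subset[OF e'(2)] by blast
  then obtain w where w: "\<And>l. l < length b \<Longrightarrow> w l \<in> free_module m (length (a 0))"
    "\<And>l. l < length b \<Longrightarrow> e' $ l - e \<bullet> w l \<in> I"
    by metis
  define \<phi> where "\<phi> = mat (length (a 0)) (length b) (\<lambda>(k, l). hcomp (b ! l - a 0 ! k) (w l $ k))"
  have \<phi>: "\<phi> \<in> graded_maps m b (a 0)"
    unfolding graded_maps_def using w(1)
    by (auto simp: \<phi>_def free_module_def intro!: hcomp_in_graded_piece)
  have col: "e' $ l - (\<Sum>k<length (a 0). e $ k * \<phi> $$ (k, l)) \<in> I" if l: "l < length b" for l
  proof -
    have "hcomp (b ! l) (e \<bullet> w l) = (\<Sum>k<length (a 0). hcomp (b ! l) (e $ k * w l $ k))"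
      using w(1)[OF l] by (simp add: free_module_def scalar_prod_lessThan[of _ "length (a 0)"] hcomp_sum)
    also have "\<dots> = (\<Sum>k<length (a 0). e $ k * \<phi> $$ (k, l))"
      using l by (intro sum.cong refl) (simp add: hcomp_mult[OF resolution_aug_graded[OF a]] \<phi>_def)
    finally have "hcomp (b ! l) (e' $ l - e \<bullet> w l) = e' $ l - (\<Sum>k<length (a 0). e $ k * \<phi> $$ (k, l))"
      by (simp add: hcomp_diff hcomp_eq_self[OF e'(2)[OF l]])
    then show ?thesis using hom[OF w(2)[OF l], of "b ! l"] by simp
  qed
  have "e' \<bullet> v - e \<bullet> (\<phi> *\<^sub>v v) \<in> I" if v: "v \<in> free_module m (length b)" for v
  proof -
    have vc: "v \<in> carrier_vec (length b)" using v by (simp add: free_module_def)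
    note \<phi>c = graded_maps_carrier_mat[OF \<phi>]
    have "e \<bullet> (\<phi> *\<^sub>v v) = (\<Sum>k<length (a 0). e $ k * (\<Sum>l<length b. \<phi> $$ (k, l) * v $ l))"
      using mult_mat_vec_entry[OF \<phi>c vc]
      by (subst scalar_prod_lessThan[OF mult_mat_vec_carrier[OF \<phi>c vc]]) simp
    also have "\<dots> = (\<Sum>l<length b. \<Sum>k<length (a 0). e $ k * (\<phi> $$ (k, l) * v $ l))"
      by (subst sum.swap) (simp add: sum_distrib_left)
    also have "\<dots> = (\<Sum>l<length b. v $ l * (\<Sum>k<length (a 0). e $ k * \<phi> $$ (k, l)))"
      by (simp add: sum_distrib_left ac_simps)
    finally have "e' \<bullet> v - e \<bullet> (\<phi> *\<^sub>v v) =
      (\<Sum>l<length b. v $ l * (e' $ l - (\<Sum>k<length (a 0). e $ k * \<phi> $$ (k, l))))"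
      by (simp add: scalar_prod_lessThan[OF vc] right_diff_distrib sum_subtractf mult.commute)
    also have "\<dots> \<in> I"
      using v col by (intro ideal_poly_sum[OF I] ideal_poly_mult[OF I]) (auto simp: free_module_def)
    finally show ?thesis .
  qed
  then show ?thesis using \<phi> by blast
qed

text \<open>
  The comparison maps \<open>\<phi>\<close>, \<open>\<psi>\<close> and the homotopy \<open>h\<close> are built together, one homological degree at a time. The
  first two clauses of the conclusion say that \<open>\<phi>\<close> and \<open>\<psi>\<close> extend one degree further. In a full homotopy
  the residue \<open>\<psi> \<phi> - 1 - D' h\<close> in degree \<open>i + 1\<close> would be \<open>h D'\<close> with the previous \<open>h\<close>; only two consequences
  of this are carried along, namely that the residue vanishes on the image of the next differential, so that \<open>h\<close>
  extends, and that its entries have no constant term, by minimality of \<open>D'\<close>. This keeps the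
  statement free of references to degree \<open>i - 1\<close>.
\<close>
lemma comparison_homotopic_to_identity:
  fixes I :: "'k::comm_ring_1 pol set"
  assumes I: "ideal I (poly_ring m)" and hom: "\<And>p d. p \<in> I \<Longrightarrow> hcomp d p \<in> I"
    and a: "graded_free_resolution m I a e D"
    and b: "minimal_graded_free_resolution m I b e' D'"
  shows "\<exists>\<phi>\<in>graded_maps m (b i) (a i). \<exists>\<psi>\<in>graded_maps m (a i) (b i). \<exists>h\<in>graded_maps m (b i) (b (Suc i)).
    (\<exists>N\<in>graded_maps m (b (Suc i)) (a (Suc i)). D i * N = \<phi> * D' i) \<and>
    (\<exists>N\<in>graded_maps m (a (Suc i)) (b (Suc i)). D' i * N = \<psi> * D i) \<and>
    (\<psi> * \<phi> - 1\<^sub>m (length (b i)) - D' i * h) * D' i = 0\<^sub>m (length (b i)) (length (b (Suc i))) \<and>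
    elements_mat (\<psi> * \<phi> - 1\<^sub>m (length (b i)) - D' i * h) \<subseteq> irrelevant_ideal m"
proof (induction i)
  have b': "graded_free_resolution m I b e' D'" and min: "\<And>i. elements_mat (D' i) \<subseteq> irrelevant_ideal m"
    using b by (auto simp: minimal_graded_free_resolution_def)
  have zero_in: "elements_mat (0\<^sub>m r c :: 'k pol mat) \<subseteq> irrelevant_ideal m" for r c
    using elements_0_mat by (fastforce simp: irrelevant_ideal_def)
  note aD = resolution_maps[OF a] and bD = resolution_maps[OF b']
  note carr = graded_maps_carrier_mat
  {
    case 0
    obtain \<phi> where \<phi>: "\<phi> \<in> graded_maps m (b 0) (a 0)"
      "\<And>v. v \<in> free_module m (length (b 0)) \<Longrightarrow> e' \<bullet> v - e \<bullet> (\<phi> *\<^sub>v v) \<in> I"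
      using resolution_lift_identity[OF I hom a resolution_aug_carrier[OF b'] resolution_aug_graded[OF b']]
      by blast
    obtain \<psi> where \<psi>: "\<psi> \<in> graded_maps m (a 0) (b 0)"
      "\<And>v. v \<in> free_module m (length (a 0)) \<Longrightarrow> e \<bullet> v - e' \<bullet> (\<psi> *\<^sub>v v) \<in> I"
      using resolution_lift_identity[OF I hom b' resolution_aug_carrier[OF a] resolution_aug_graded[OF a]]
      by blast
    have aug: "u \<bullet> col (D'' 0) l \<in> I" if "graded_free_resolution m I c u D''" "l < length (c (Suc 0))"
      for c u D'' l
    proof -
      have "col (D'' 0) l \<in> (\<lambda>w. D'' 0 *\<^sub>v w) ` free_module m (length (c 1))"
        using col_eq_mult_unit_vec[OF carr[OF resolution_maps[OF that(1)]] that(2)] unit_vec_free_module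
        by auto
      then show ?thesis using resolution_exact_0[OF that(1)] by blast
    qed
    have step: "\<exists>N\<in>graded_maps m (c' (Suc 0)) (c (Suc 0)). D1 0 * N = \<chi> * D2 0"
      if c: "graded_free_resolution m I c u D1" and c': "graded_free_resolution m I c' u' D2"
        and \<chi>: "\<chi> \<in> graded_maps m (c' 0) (c 0)"
        "\<And>v. v \<in> free_module m (length (c' 0)) \<Longrightarrow> u' \<bullet> v - u \<bullet> (\<chi> *\<^sub>v v) \<in> I"
      for c u D1 c' u' D2 \<chi>
    proof (rule resolution_lift_0[OF c])
      show "\<chi> * D2 0 \<in> graded_maps m (c' (Suc 0)) (c 0)"
        using graded_maps_mult[OF \<chi>(1) resolution_maps[OF c']] .
      fix l assume l: "l < length (c' (Suc 0))"
      have "u' \<bullet> col (D2 0) l - (u' \<bullet> col (D2 0) l - u \<bullet> (\<chi> *\<^sub>v col (D2 0) l)) \<in> I"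
        by (intro ideal_poly_diff[OF I] aug[OF c' l] \<chi>(2) graded_maps_col[OF resolution_maps[OF c'] l])
      then show "u \<bullet> col (\<chi> * D2 0) l \<in> I"
        by (simp add: col_mult2[OF carr[OF \<chi>(1)] carr[OF resolution_maps[OF c']] l])
    qed
    have "\<exists>h\<in>graded_maps m (b 0) (b (Suc 0)). D' 0 * h = \<psi> * \<phi> - 1\<^sub>m (length (b 0))"
    proof (rule resolution_lift_0[OF b'])
      show "\<psi> * \<phi> - 1\<^sub>m (length (b 0)) \<in> graded_maps m (b 0) (b 0)"
        using graded_maps_minus[OF graded_maps_mult[OF \<psi>(1) \<phi>(1)] graded_maps_one] .
      fix l assume l: "l < length (b 0)"
      have col: "col (\<psi> * \<phi> - 1\<^sub>m (length (b 0))) l = \<psi> *\<^sub>v (\<phi> *\<^sub>v unit_vec (length (b 0)) l) - unit_vec (length (b 0)) l"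
      proof -
        have "col (\<psi> * \<phi> - 1\<^sub>m (length (b 0))) l = col (\<psi> * \<phi>) l - unit_vec (length (b 0)) l"
          using l carr[OF \<psi>(1)] carr[OF \<phi>(1)] by (intro eq_vecI) auto
        then show ?thesis
          using col_mult2[OF carr[OF \<psi>(1)] carr[OF \<phi>(1)] l] col_eq_mult_unit_vec[OF carr[OF \<phi>(1)] l] by simp
      qed
      define v :: "'k pol vec" where "v = unit_vec (length (b 0)) l"
      have v: "v \<in> free_module m (length (b 0))" unfolding v_def by (rule unit_vec_free_module)
      have \<phi>v: "\<phi> *\<^sub>v v \<in> free_module m (length (a 0))" by (rule graded_maps_mult_vec[OF \<phi>(1) v])
      have \<psi>v: "\<psi> *\<^sub>v (\<phi> *\<^sub>v v) \<in> free_module m (length (b 0))" by (rule graded_maps_mult_vec[OF \<psi>(1) \<phi>v])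
      have "0 - ((e' \<bullet> v - e \<bullet> (\<phi> *\<^sub>v v)) + (e \<bullet> (\<phi> *\<^sub>v v) - e' \<bullet> (\<psi> *\<^sub>v (\<phi> *\<^sub>v v)))) \<in> I"
        by (intro ideal_poly_diff[OF I] ideal_poly_add[OF I] ideal_poly_0[OF I] \<phi>(2) \<psi>(2) v \<phi>v)
      moreover have "e' \<bullet> (\<psi> *\<^sub>v (\<phi> *\<^sub>v v) - v) = e' \<bullet> (\<psi> *\<^sub>v (\<phi> *\<^sub>v v)) - e' \<bullet> v"
        using scalar_prod_minus_distrib[OF resolution_aug_carrier[OF b']] v \<psi>v by (simp add: free_module_def)
      ultimately show "e' \<bullet> col (\<psi> * \<phi> - 1\<^sub>m (length (b 0))) l \<in> I"
        unfolding col v_def[symmetric] by simp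
    qed
    then obtain h where h: "h \<in> graded_maps m (b 0) (b (Suc 0))" "D' 0 * h = \<psi> * \<phi> - 1\<^sub>m (length (b 0))"
      by blast
    have "\<psi> * \<phi> - 1\<^sub>m (length (b 0)) - D' 0 * h = 0\<^sub>m (length (b 0)) (length (b 0))"
      unfolding h(2) using carr[OF \<psi>(1)] carr[OF \<phi>(1)] by (intro minus_r_inv_mat) auto
    then show ?case
      using step[OF a b' \<phi>] step[OF b' a \<psi>] zero_in carr[OF bD, of 0]
      by (rule_tac bexI[OF _ \<phi>(1)], rule_tac bexI[OF _ \<psi>(1)], rule_tac bexI[OF _ h(1)]) simp
  next
    case (Suc i)
    then obtain \<phi> \<psi> h \<phi>' \<psi>' where
      \<phi>: "\<phi> \<in> graded_maps m (b i) (a i)" and \<psi>: "\<psi> \<in> graded_maps m (a i) (b i)"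
      and h: "h \<in> graded_maps m (b i) (b (Suc i))"
      and \<phi>': "\<phi>' \<in> graded_maps m (b (Suc i)) (a (Suc i))" "D i * \<phi>' = \<phi> * D' i"
      and \<psi>': "\<psi>' \<in> graded_maps m (a (Suc i)) (b (Suc i))" "D' i * \<psi>' = \<psi> * D i"
      and res: "(\<psi> * \<phi> - 1\<^sub>m (length (b i)) - D' i * h) * D' i = 0\<^sub>m (length (b i)) (length (b (Suc i)))"
      by blast
    let ?r = "\<lambda>c i. length (c i :: int list)"
    note c\<phi> = carr[OF \<phi>] and c\<psi> = carr[OF \<psi>] and ch = carr[OF h]
      and c\<phi>' = carr[OF \<phi>'(1)] and c\<psi>' = carr[OF \<psi>'(1)]
      and caD = carr[OF aD] and cbD = carr[OF bD]
    have next_square: "\<exists>N\<in>graded_maps m (c' (Suc (Suc i))) (c (Suc (Suc i))). D1 (Suc i) * N = \<chi>' * D2 (Suc i)"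
      if c: "graded_free_resolution m I c u D1" and c': "graded_free_resolution m I c' u' D2"
        and \<chi>: "\<chi> \<in> graded_maps m (c' i) (c i)" and \<chi>': "\<chi>' \<in> graded_maps m (c' (Suc i)) (c (Suc i))"
        and eq: "D1 i * \<chi>' = \<chi> * D2 i"
      for c u D1 c' u' D2 \<chi> \<chi>'
    proof (rule resolution_lift[OF c])
      note D1 = carr[OF resolution_maps[OF c]] and D2 = carr[OF resolution_maps[OF c']]
      show "\<chi>' * D2 (Suc i) \<in> graded_maps m (c' (Suc (Suc i))) (c (Suc i))"
        using graded_maps_mult[OF \<chi>' resolution_maps[OF c']] .
      have "D1 i * (\<chi>' * D2 (Suc i)) = \<chi> * (D2 i * D2 (Suc i))"
        unfolding assoc_mult_mat[OF D1 carr[OF \<chi>'] D2, symmetric] eq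
        by (rule assoc_mult_mat[OF carr[OF \<chi>] D2 D2])
      then show "D1 i * (\<chi>' * D2 (Suc i)) = 0\<^sub>m (length (c i)) (length (c' (Suc (Suc i))))"
        using resolution_complex[OF c'] carr[OF \<chi>] by simp
    qed
    \<comment> \<open>what the next \<open>h\<close> has to be a preimage of; it is a cycle by the clause on the residue\<close>
    let ?M = "\<psi>' * \<phi>' - 1\<^sub>m (length (b (Suc i))) - h * D' i"
    have M: "?M \<in> graded_maps m (b (Suc i)) (b (Suc i))"
      by (intro graded_maps_minus graded_maps_mult[OF \<psi>'(1) \<phi>'(1)] graded_maps_one graded_maps_mult[OF h bD])
    have p1: "\<psi>' * \<phi>' \<in> carrier_mat (?r b (Suc i)) (?r b (Suc i))"
      and p2: "h * D' i \<in> carrier_mat (?r b (Suc i)) (?r b (Suc i))"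
      and p3: "\<psi> * \<phi> \<in> carrier_mat (?r b i) (?r b i)"
      and p4: "D' i * h \<in> carrier_mat (?r b i) (?r b i)"
      using c\<phi> c\<psi> ch c\<phi>' c\<psi>' cbD by (meson mult_carrier_mat)+
    have one: "1\<^sub>m r \<in> carrier_mat r r" for r by simp
    have "D' i * ?M = D' i * (\<psi>' * \<phi>') - D' i - D' i * (h * D' i)"
      using mult_minus_distrib_mat[OF cbD[of i] minus_carrier_mat[OF one] p2, of "\<psi>' * \<phi>'"]
        mult_minus_distrib_mat[OF cbD[of i] p1 one] right_mult_one_mat[OF cbD[of i]] by simp
    also have "D' i * (\<psi>' * \<phi>') = \<psi> * \<phi> * D' i"
      unfolding assoc_mult_mat[OF cbD c\<psi>' c\<phi>', symmetric] \<psi>'(2) assoc_mult_mat[OF c\<psi> caD c\<phi>']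
        \<phi>'(2) by (rule assoc_mult_mat[OF c\<psi> c\<phi> cbD, symmetric])
    also have "D' i * (h * D' i) = D' i * h * D' i"
      using assoc_mult_mat[OF cbD ch cbD] by simp
    also have "\<psi> * \<phi> * D' i - D' i - D' i * h * D' i = (\<psi> * \<phi> - 1\<^sub>m (length (b i)) - D' i * h) * D' i"
      using minus_mult_distrib_mat[OF minus_carrier_mat[OF one] p4 cbD[of i], of "\<psi> * \<phi>"]
        minus_mult_distrib_mat[OF p3 one cbD[of i]] left_mult_one_mat[OF cbD[of i]] by simp
    finally have "D' i * ?M = 0\<^sub>m (length (b i)) (length (b (Suc i)))" using res by simp
    then obtain h' where h': "h' \<in> graded_maps m (b (Suc i)) (b (Suc (Suc i)))" "D' (Suc i) * h' = ?M"
      using resolution_lift[OF b' M] by blast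
    have rest: "\<psi>' * \<phi>' - 1\<^sub>m (length (b (Suc i))) - D' (Suc i) * h' = h * D' i"
      unfolding h'(2) using p1 p2 by (intro eq_matI) auto
    have "h * D' i * D' (Suc i) = h * (D' i * D' (Suc i))"
      by (rule assoc_mult_mat[OF ch cbD cbD])
    then have "h * D' i * D' (Suc i) = 0\<^sub>m (length (b (Suc i))) (length (b (Suc (Suc i))))"
      using resolution_complex[OF b'] ch by simp
    moreover have "elements_mat (h * D' i) \<subseteq> irrelevant_ideal m"
      using elements_mat_mult_irrelevant[OF h bD] min by blast
    ultimately show ?case
      using next_square[OF a b' \<phi> \<phi>'] next_square[OF b' a \<psi> \<psi>']
      by (rule_tac bexI[OF _ \<phi>'(1)], rule_tac bexI[OF _ \<psi>'(1)], rule_tac bexI[OF _ h'(1)])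
        (simp only: rest)
  }
qed

text \<open>
  Modulo the variables \<open>\<psi> \<phi>\<close> is the identity, so the \<open>l\<close>-th column of \<open>\<phi>\<close> has an entry with nonzero constant
  term. Being homogeneous, this entry has degree \<open>0\<close>, which forces the two shifts that it connects to be
  equal.
\<close>
lemma minimal_resolution_shifts_subset:
  fixes I :: "'k::comm_ring_1 pol set"
  assumes I: "ideal I (poly_ring m)" and hom: "\<And>p d. p \<in> I \<Longrightarrow> hcomp d p \<in> I"
    and a: "graded_free_resolution m I a e D"
    and b: "minimal_graded_free_resolution m I b e' D'"
  shows "set (b i) \<subseteq> set (a i)"
proof
  fix j assume "j \<in> set (b i)"
  then obtain l where l: "l < length (b i)" "j = b i ! l" by (metis in_set_conv_nth)
  obtain \<phi> \<psi> h where \<phi>: "\<phi> \<in> graded_maps m (b i) (a i)" and \<psi>: "\<psi> \<in> graded_maps m (a i) (b i)"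
    and h: "h \<in> graded_maps m (b i) (b (Suc i))"
    and res: "elements_mat (\<psi> * \<phi> - 1\<^sub>m (length (b i)) - D' i * h) \<subseteq> irrelevant_ideal m"
    using comparison_homotopic_to_identity[OF I hom a b, of i] by blast
  have D': "D' i \<in> graded_maps m (b (Suc i)) (b i)"
    and min: "elements_mat (D' i) \<subseteq> irrelevant_ideal m"
    using b resolution_maps by (auto simp: minimal_graded_free_resolution_def)
  note c = graded_maps_carrier_mat[OF graded_maps_mult[OF \<psi> \<phi>]] graded_maps_carrier_mat[OF graded_maps_mult[OF D' h]]
  have "(D' i * h) $$ (l, l) \<in> irrelevant_ideal m"
    using elements_mat_mult_irrelevant[OF D' h] min elements_matI[OF c(2) l(1) l(1) refl] by blast
  moreover have "(\<psi> * \<phi> - 1\<^sub>m (length (b i)) - D' i * h) $$ (l, l) \<in> irrelevant_ideal m"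
    using elements_matI[OF minus_carrier_mat[OF c(2)] l(1) l(1) refl] res by blast
  moreover have "(A - 1\<^sub>m n - B) $$ (l, l) = A $$ (l, l) - 1 - B $$ (l, l)"
    if "A \<in> carrier_mat n n" "B \<in> carrier_mat n n" "l < n" for A B :: "'k pol mat" and n
    using that by simp
  note this[OF c l(1)]
  ultimately have "Poly_Mapping.lookup ((\<psi> * \<phi>) $$ (l, l)) 0 = 1"
    by (simp add: irrelevant_ideal_def lookup_minus)
  then have "(\<Sum>k<length (a i). Poly_Mapping.lookup (\<psi> $$ (l, k)) 0 * Poly_Mapping.lookup (\<phi> $$ (k, l)) 0) \<noteq> 0"
    using mult_mat_entry[OF graded_maps_carrier_mat[OF \<psi>] graded_maps_carrier_mat[OF \<phi>] l(1) l(1)]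
    by (simp add: lookup_sum lookup_mult_0)
  then obtain k where k: "k < length (a i)" "Poly_Mapping.lookup (\<phi> $$ (k, l)) 0 \<noteq> 0"
    by (metis (no_types, lifting) lessThan_iff mult_zero_right sum.neutral)
  have "0 \<in> Poly_Mapping.keys (\<phi> $$ (k, l))" using k(2) by (simp add: in_keys_iff)
  then have "int (deg_monom 0) = b i ! l - a i ! k"
    using graded_maps_entry[OF \<phi> k(1) l(1)] by (simp only: graded_piece_def mem_Collect_eq)
  then have "j = a i ! k" using l(2) by simp
  then show "j \<in> set (a i)" using k(1) by simp
qed

theorem minimal_resolution_shifts_unique:
  assumes "ideal I (poly_ring m)" "\<And>p d. p \<in> I \<Longrightarrow> hcomp d p \<in> I"
    and "minimal_graded_free_resolution m I a e D"
    and "minimal_graded_free_resolution m I b e' D'"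
  shows "set (b i) = set (a i)"
  using minimal_resolution_shifts_subset[OF assms(1,2)] assms(3,4)
  unfolding minimal_graded_free_resolution_def by blast

corollary regularity_eqI:
  assumes "ideal I (poly_ring m)" "\<And>p d. p \<in> I \<Longrightarrow> hcomp d p \<in> I"
    and a: "minimal_graded_free_resolution m I a e D"
  shows "regularity m I = Max {j - int i | i j. j \<in> set (a i)}"
  unfolding regularity_def
proof (rule the_equality)
  show "\<exists>a' e D. minimal_graded_free_resolution m I a' e D \<and>
      Max {j - int i | i j. j \<in> set (a i)} = Max {j - int i | i j. j \<in> set (a' i)}"
    using a by blast
  fix r assume "\<exists>a e D. minimal_graded_free_resolution m I a e D \<and> r = Max {j - int i | i j. j \<in> set (a i)}"
  then show "r = Max {j - int i | i j. j \<in> set (a i)}"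
    using minimal_resolution_shifts_unique[OF assms(1,2) a] by auto
qed

section \<open>Adding a form that is a nonzerodivisor: the mapping cone\<close>

text \<open>
  The cone of multiplication by a form \<open>f\<close> of degree \<open>d\<close> on a resolution \<open>F\<close> has \<open>F\<^sub>i \<oplus> F\<^bsub>i-1\<^esub>(-d)\<close> in homological
  degree \<open>i\<close>. With the convention \<open>F\<^bsub>-1\<^esub> = 0\<close>, i.e. a matrix without rows in place of the differential
  \<open>F\<^sub>0 \<rightarrow> F\<^bsub>-1\<^esub>\<close>, degree \<open>0\<close> is covered by the same formulas as all the others.
\<close>
definition prev_shifts :: "int \<Rightarrow> (nat \<Rightarrow> int list) \<Rightarrow> nat \<Rightarrow> int list" where
  "prev_shifts d a i = (case i of 0 \<Rightarrow> [] | Suc j \<Rightarrow> map ((+) d) (a j))"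

definition prev_map :: "(nat \<Rightarrow> int list) \<Rightarrow> (nat \<Rightarrow> 'k::comm_ring_1 pol mat) \<Rightarrow> nat \<Rightarrow> 'k pol mat" where
  "prev_map a D i = (case i of 0 \<Rightarrow> 0\<^sub>m 0 (length (a 0)) | Suc j \<Rightarrow> D j)"

definition cone_shifts :: "int \<Rightarrow> (nat \<Rightarrow> int list) \<Rightarrow> nat \<Rightarrow> int list" where
  "cone_shifts d a i = a i @ prev_shifts d a i"

definition cone_map ::
  "'k::comm_ring_1 pol \<Rightarrow> (nat \<Rightarrow> int list) \<Rightarrow> (nat \<Rightarrow> 'k pol mat) \<Rightarrow> nat \<Rightarrow> 'k pol mat"
where
  "cone_map f a D i = four_block_mat (D i) (f \<cdot>\<^sub>m 1\<^sub>m (length (a i)))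
     (0\<^sub>m (length (prev_shifts 0 a i)) (length (a (Suc i)))) (- prev_map a D i)"

lemma length_prev_shifts: "length (prev_shifts d a i) = (case i of 0 \<Rightarrow> 0 | Suc j \<Rightarrow> length (a j))"
  by (simp add: prev_shifts_def split: nat.split)

lemma prev_shifts_Suc [simp]: "prev_shifts d a (Suc i) = map ((+) d) (a i)"
  and prev_map_Suc [simp]: "prev_map a D (Suc i) = D i"
  and prev_shifts_0 [simp]: "prev_shifts d a 0 = []"
  and prev_map_0 [simp]: "prev_map a D 0 = 0\<^sub>m 0 (length (a 0))"
  by (simp_all add: prev_shifts_def prev_map_def)

lemma graded_maps_uminus: "M \<in> graded_maps m a b \<Longrightarrow> - M \<in> graded_maps m a b"
  by (auto simp: graded_maps_def intro!: graded_piece_uminus)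

lemma free_module_append:
  "v \<in> free_module m r \<Longrightarrow> w \<in> free_module m s \<Longrightarrow> v @\<^sub>v w \<in> free_module m (r + s)"
  by (auto simp: free_module_def)

lemma free_module_append_cases:
  assumes "x \<in> free_module m (r + s)"
  obtains v w where "x = v @\<^sub>v w" "v \<in> free_module m r" "w \<in> free_module m s"
proof
  have x: "x \<in> carrier_vec (r + s)" using assms by (simp add: free_module_def)
  show "x = vec_first x r @\<^sub>v vec_last x s" using vec_first_last_append[OF x] by simp
  show "vec_first x r \<in> free_module m r" "vec_last x s \<in> free_module m s"
    using assms by (auto simp: free_module_def vec_first_def vec_last_def)
qed

lemma free_module_carrier: "v \<in> free_module m r \<Longrightarrow> v \<in> carrier_vec r"
  by (simp add: free_module_def)

lemma free_module_add: "v \<in> free_module m r \<Longrightarrow> w \<in> free_module m r \<Longrightarrow> v + w \<in> free_module m r"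
  by (auto simp: free_module_def intro!: poly_ring_add)

lemma free_module_uminus: "v \<in> free_module m r \<Longrightarrow> - v \<in> free_module m r"
  by (auto simp: free_module_def intro!: poly_ring_uminus)

lemma free_module_smult:
  "p \<in> carrier (poly_ring m) \<Longrightarrow> v \<in> free_module m r \<Longrightarrow> p \<cdot>\<^sub>v v \<in> free_module m r"
  by (auto simp: free_module_def intro!: poly_ring_mult)

lemma free_module_scalar_prod:
  "v \<in> free_module m r \<Longrightarrow> w \<in> free_module m r \<Longrightarrow> v \<bullet> w \<in> carrier (poly_ring m)"
  by (auto simp: free_module_def scalar_prod_def intro!: poly_ring_sum poly_ring_mult)

lemma mult_mat_vec_smult:
  fixes A :: "'a::comm_ring_1 mat"
  assumes "A \<in> carrier_mat r c" "v \<in> carrier_vec c"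
  shows "A *\<^sub>v (p \<cdot>\<^sub>v v) = p \<cdot>\<^sub>v (A *\<^sub>v v)"
  using assms by (intro eq_vecI) auto

lemma mult_mat_vec_uminus:
  fixes A :: "'a::comm_ring_1 mat"
  assumes "A \<in> carrier_mat r c" "v \<in> carrier_vec c"
  shows "A *\<^sub>v (- v) = - (A *\<^sub>v v)"
  using assms by (intro eq_vecI) auto

lemma smult_one_mat_mult_vec:
  fixes p :: "'a::comm_ring_1"
  assumes "v \<in> carrier_vec r"
  shows "(p \<cdot>\<^sub>m 1\<^sub>m r) *\<^sub>v v = p \<cdot>\<^sub>v v"
proof (rule eq_vecI)
  fix i assume "i < dim_vec (p \<cdot>\<^sub>v v)"
  then have i: "i < r" using assms by simp
  have "row (p \<cdot>\<^sub>m 1\<^sub>m r) i = p \<cdot>\<^sub>v unit_vec r i"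
    using i by (intro eq_vecI) (auto simp: unit_vec_def)
  then show "((p \<cdot>\<^sub>m 1\<^sub>m r) *\<^sub>v v) $ i = (p \<cdot>\<^sub>v v) $ i"
    using i assms by simp
qed (use assms in simp)

lemma prev_map_carrier_mat:
  assumes "graded_free_resolution m I a e D"
  shows "prev_map a D i \<in> carrier_mat (length (prev_shifts d a i)) (length (a i))"
  using graded_maps_carrier_mat[OF resolution_maps[OF assms]]
  by (cases i) simp_all

lemma cone_map_append:
  assumes a: "graded_free_resolution m I a e D"
    and v: "v \<in> carrier_vec (length (a (Suc i)))" and w: "w \<in> carrier_vec (length (a i))"
  shows "cone_map f a D i *\<^sub>v (v @\<^sub>v w) = (D i *\<^sub>v v + f \<cdot>\<^sub>v w) @\<^sub>v - (prev_map a D i *\<^sub>v w)"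
proof -
  note D = graded_maps_carrier_mat[OF resolution_maps[OF a, of i]]
  note P = prev_map_carrier_mat[OF a, of i 0]
  have "cone_map f a D i *\<^sub>v (v @\<^sub>v w) = (D i *\<^sub>v v + (f \<cdot>\<^sub>m 1\<^sub>m (length (a i))) *\<^sub>v w) @\<^sub>v
      (0\<^sub>m (length (prev_shifts 0 a i)) (length (a (Suc i))) *\<^sub>v v + (- prev_map a D i) *\<^sub>v w)"
    unfolding cone_map_def using D P v w by (intro four_block_mat_mult_vec) auto
  also have "0\<^sub>m (length (prev_shifts 0 a i)) (length (a (Suc i))) *\<^sub>v v = 0\<^sub>v (length (prev_shifts 0 a i))"
    using v by (intro eq_vecI) auto
  also have "(- prev_map a D i) *\<^sub>v w = - (prev_map a D i *\<^sub>v w)"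
    using P w by (intro uminus_mult_mat_vec) auto
  finally show ?thesis
    using smult_one_mat_mult_vec[OF w] P w by simp
qed

lemma cone_map_graded:
  assumes a: "graded_free_resolution m I a e D" and f: "f \<in> graded_piece m d"
  shows "cone_map f a D i \<in> graded_maps m (cone_shifts d a (Suc i)) (cone_shifts d a i)"
proof -
  note aD = resolution_maps[OF a]
  note D = graded_maps_carrier_mat[OF aD, of i]
  have P: "- prev_map a D i \<in> graded_maps m (map ((+) d) (a i)) (prev_shifts d a i)"
  proof (cases i)
    case (Suc j)
    have "D j \<in> graded_maps m (map ((+) d) (a (Suc j))) (map ((+) d) (a j))"
      using aD[of j] by (simp add: graded_maps_def)
    then show ?thesis using Suc by (simp add: graded_maps_uminus)
  qed (simp add: graded_maps_def)
  note Pc = graded_maps_carrier_mat[OF P]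
  have len: "length (prev_shifts 0 a i) = length (prev_shifts d a i)"
    by (simp add: length_prev_shifts)
  have "cone_map f a D i $$ (k, l) \<in> graded_piece m (cone_shifts d a (Suc i) ! l - cone_shifts d a i ! k)"
    if k: "k < length (cone_shifts d a i)" and l: "l < length (cone_shifts d a (Suc i))" for k l
  proof -
    have dims: "k < length (a i) + length (prev_shifts d a i)" "l < length (a (Suc i)) + length (a i)"
      using k l by (simp_all add: cone_shifts_def)
    then have entry: "cone_map f a D i $$ (k, l) =
      (if k < length (a i)
       then if l < length (a (Suc i)) then D i $$ (k, l)
         else if k = l - length (a (Suc i)) then f else 0
       else if l < length (a (Suc i)) then 0
         else (- prev_map a D i) $$ (k - length (a i), l - length (a (Suc i))))"
      unfolding cone_map_def using D Pc len
      by (subst index_mat_four_block) auto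
    show ?thesis
      unfolding entry
      using graded_maps_entry[OF aD, of k i l] graded_maps_entry[OF P, of "k - length (a i)" "l - length (a (Suc i))"]
        f dims by (auto simp: cone_shifts_def nth_append)
  qed
  moreover have "cone_map f a D i \<in> carrier_mat (length (cone_shifts d a i)) (length (cone_shifts d a (Suc i)))"
    unfolding cone_map_def cone_shifts_def using D Pc by (simp add: four_block_carrier_mat)
  ultimately show ?thesis by (simp add: graded_maps_def)
qed

lemma prev_map_complex:
  assumes a: "graded_free_resolution m I a e D" and u: "u \<in> free_module m (length (a (Suc i)))"
  shows "prev_map a D i *\<^sub>v (D i *\<^sub>v u) = 0\<^sub>v (length (prev_shifts d a i))"
proof (cases i)
  case 0
  then show ?thesis by (intro eq_vecI) auto
next
  case (Suc j)
  then have "D i *\<^sub>v u \<in> {v \<in> free_module m (length (a (Suc j))). D j *\<^sub>v v = 0\<^sub>v (length (a j))}"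
    unfolding resolution_exact[OF a] using u by blast
  then show ?thesis using Suc by simp
qed

text \<open>
  In a cycle \<open>(v, w)\<close> of the cone, \<open>w\<close> is a boundary of \<open>F\<close>. For \<open>i > 0\<close> this is exactness of \<open>F\<close>. For
  \<open>i = 0\<close> the condition on \<open>w\<close> alone is empty; instead \<open>f w = - D v\<close> dies in \<open>S/I\<close>, and since \<open>f\<close> is a
  nonzerodivisor on \<open>S/I\<close>, so does \<open>w\<close>.
\<close>
lemma cone_cycle_lifts:
  assumes I: "ideal I (poly_ring m)" and a: "graded_free_resolution m I a e D"
    and nzd: "\<And>h. h \<in> carrier (poly_ring m) \<Longrightarrow> h * f \<in> I \<Longrightarrow> h \<in> I"
    and v: "v \<in> free_module m (length (a (Suc i)))" and w: "w \<in> free_module m (length (a i))"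
    and cycle: "D i *\<^sub>v v + f \<cdot>\<^sub>v w = 0\<^sub>v (length (a i))"
      "prev_map a D i *\<^sub>v w = 0\<^sub>v (length (prev_shifts 0 a i))"
  shows "\<exists>u\<in>free_module m (length (a (Suc i))). w = D i *\<^sub>v u"
proof (cases i)
  case 0
  have e: "e \<in> free_module m (length (a 0))"
    using resolution_aug_carrier[OF a] resolution_aug_graded[OF a] graded_piece_subset
    by (auto simp: free_module_def)
  have w0: "w \<in> free_module m (length (a 0))" using w 0 by simp
  have Dv: "D 0 *\<^sub>v v \<in> free_module m (length (a 0))" "e \<bullet> (D 0 *\<^sub>v v) \<in> I"
    using resolution_exact_0[OF a] v 0 by auto
  have "e \<bullet> (D 0 *\<^sub>v v + f \<cdot>\<^sub>v w) = e \<bullet> (D 0 *\<^sub>v v) + f * (e \<bullet> w)"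
    using free_module_carrier[OF e] free_module_carrier[OF Dv(1)] free_module_carrier[OF w0]
    by (subst scalar_prod_add_distrib[of _ "length (a 0)"]) auto
  then have "0 = e \<bullet> (D 0 *\<^sub>v v) + f * (e \<bullet> w)"
    using cycle(1) 0 free_module_carrier[OF e] by simp
  then have "(e \<bullet> w) * f = 0 - e \<bullet> (D 0 *\<^sub>v v)"
    by (simp add: eq_neg_iff_add_eq_0 ac_simps)
  then have "(e \<bullet> w) * f \<in> I"
    using ideal_poly_diff[OF I ideal_poly_0[OF I] Dv(2)] by simp
  then have "e \<bullet> w \<in> I" by (rule nzd[OF free_module_scalar_prod[OF e w0]])
  with w0 have "w \<in> {v \<in> free_module m (length (a 0)). e \<bullet> v \<in> I}" by simp
  then have "w \<in> (\<lambda>w. D 0 *\<^sub>v w) ` free_module m (length (a 1))"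
    unfolding resolution_exact_0[OF a] .
  then show ?thesis using 0 by auto
next
  case (Suc j)
  then show ?thesis using resolution_exact[OF a, of j] w cycle(2) by auto
qed

lemma smult_uminus_add:
  fixes v u :: "'a::comm_ring_1 vec"
  assumes "u \<in> carrier_vec r" "v \<in> carrier_vec r"
  shows "(v + p \<cdot>\<^sub>v u) + p \<cdot>\<^sub>v (- u) = v"
  using assms by (intro eq_vecI) auto

text \<open>
  Let \<open>(v, w)\<close> be a cycle of the cone and \<open>w = D u\<close>. Then \<open>v + f u\<close> is a cycle of \<open>F\<close>, hence equal to \<open>D z\<close>,
  and \<open>(v, w)\<close> is the image of \<open>(z, -u)\<close>. At the augmentation the same correction shows that a
  vector mapping into \<open>I + (f)\<close> differs from a multiple of \<open>f\<close> by a vector mapping into \<open>I\<close>.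
\<close>
proposition mapping_cone_resolution:
  assumes I: "ideal I (poly_ring m)" and a: "graded_free_resolution m I a e D"
    and f: "f \<in> graded_piece m d"
    and nzd: "\<And>h. h \<in> carrier (poly_ring m) \<Longrightarrow> h * f \<in> I \<Longrightarrow> h \<in> I"
  shows "graded_free_resolution m {g + h * f | g h. g \<in> I \<and> h \<in> carrier (poly_ring m)}
    (cone_shifts d a) e (cone_map f a D)"
proof -
  let ?I = "{g + h * f | g h. g \<in> I \<and> h \<in> carrier (poly_ring m)}"
  let ?F = "\<lambda>i. free_module m (length (a i))"
  note fc = graded_piece_subset[OF f]
  note cD = graded_maps_carrier_mat[OF resolution_maps[OF a]]
  note fmc = free_module_carrier
  have e: "e \<in> ?F 0"
    using resolution_aug_carrier[OF a] resolution_aug_graded[OF a] graded_piece_subset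
    by (auto simp: free_module_def)
  have DF: "D i *\<^sub>v v \<in> ?F i" if "v \<in> ?F (Suc i)" for i v
    by (rule graded_maps_mult_vec[OF resolution_maps[OF a] that])
  have cone0: "length (cone_shifts d a 0) = length (a 0)"
    and coneSuc: "length (cone_shifts d a (Suc i)) = length (a (Suc i)) + length (a i)" for i
    by (simp_all add: cone_shifts_def)
  have maps: "\<forall>i. cone_map f a D i \<in> carrier_mat (length (cone_shifts d a i)) (length (cone_shifts d a (Suc i))) \<and>
      (\<forall>k<length (cone_shifts d a i). \<forall>l<length (cone_shifts d a (Suc i)).
        cone_map f a D i $$ (k, l) \<in> graded_piece m (cone_shifts d a (Suc i) ! l - cone_shifts d a i ! k))"
    using cone_map_graded[OF a f] by (simp add: graded_maps_def)
  have surj: "\<exists>v\<in>?F 0. g - e \<bullet> v \<in> ?I" if g: "g \<in> carrier (poly_ring m)" for g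
  proof -
    obtain v where "v \<in> ?F 0" "g - e \<bullet> v \<in> I" using resolution_aug_surj[OF a g] by blast
    moreover have "g - e \<bullet> v = (g - e \<bullet> v) + 0 * f" by simp
    ultimately show ?thesis using poly_ring_0 by blast
  qed
  have append0: "x @\<^sub>v y = x" if "y \<in> carrier_vec 0" for x y :: "'a pol vec"
    using that by (intro eq_vecI) auto
  have cone_map0: "cone_map f a D 0 *\<^sub>v (v @\<^sub>v w) = D 0 *\<^sub>v v + f \<cdot>\<^sub>v w" if "v \<in> ?F (Suc 0)" "w \<in> ?F 0" for v w
    unfolding cone_map_append[OF a fmc[OF that(1)] fmc[OF that(2)]]
    by (rule append0) (rule carrier_vecI, simp)
  have aug: "e \<bullet> (x + f \<cdot>\<^sub>v w) = e \<bullet> x + (e \<bullet> w) * f" if "x \<in> ?F 0" "w \<in> ?F 0" for x w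
    using fmc[OF e] fmc[OF that(1)] fmc[OF that(2)]
    by (subst scalar_prod_add_distrib[of _ "length (a 0)"]) (auto simp: mult.commute)
  have exact0: "{v \<in> ?F 0. e \<bullet> v \<in> ?I} =
      (\<lambda>w. cone_map f a D 0 *\<^sub>v w) ` free_module m (length (a (Suc 0)) + length (a 0))"
  proof (intro subset_antisym subsetI)
    fix x assume "x \<in> {v \<in> ?F 0. e \<bullet> v \<in> ?I}"
    then have "x \<in> ?F 0" "\<exists>g h. e \<bullet> x = g + h * f \<and> g \<in> I \<and> h \<in> carrier (poly_ring m)"
      by simp_all
    then obtain g h where x: "x \<in> ?F 0" "e \<bullet> x = g + h * f" "g \<in> I" "h \<in> carrier (poly_ring m)"
      by metis
    obtain w where w: "w \<in> ?F 0" "h - e \<bullet> w \<in> I" using resolution_aug_surj[OF a x(4)] by blast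
    \<comment> \<open>subtracting \<open>f w\<close> removes the part \<open>h f\<close> of the image of \<open>x\<close>\<close>
    let ?y = "x + f \<cdot>\<^sub>v (- w)"
    have "e \<bullet> ?y = g + f * (h - e \<bullet> w)"
      unfolding aug[OF x(1) free_module_uminus[OF w(1)]]
      using x(2) fmc[OF e] fmc[OF w(1)] by (simp add: algebra_simps)
    moreover have "g + f * (h - e \<bullet> w) \<in> I"
      by (intro ideal_poly_add[OF I] ideal_poly_mult[OF I] x(3) w(2) fc)
    moreover have "?y \<in> ?F 0"
      by (intro free_module_add free_module_smult free_module_uminus x(1) w(1) fc)
    ultimately have "?y \<in> {v \<in> ?F 0. e \<bullet> v \<in> I}" by simp
    then obtain u where u: "u \<in> ?F (Suc 0)" "?y = D 0 *\<^sub>v u"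
      unfolding resolution_exact_0[OF a] by auto
    have "x = cone_map f a D 0 *\<^sub>v (u @\<^sub>v w)"
      unfolding cone_map0[OF u(1) w(1)] u(2)[symmetric]
      using fmc[OF x(1)] fmc[OF w(1)] by (intro eq_vecI) auto
    then show "x \<in> (\<lambda>w. cone_map f a D 0 *\<^sub>v w) ` free_module m (length (a (Suc 0)) + length (a 0))"
      using free_module_append[OF u(1) w(1)] by blast
  next
    fix x assume "x \<in> (\<lambda>w. cone_map f a D 0 *\<^sub>v w) ` free_module m (length (a (Suc 0)) + length (a 0))"
    then obtain y where y: "y \<in> free_module m (length (a (Suc 0)) + length (a 0))" "x = cone_map f a D 0 *\<^sub>v y"
      by blast
    obtain u w where uw: "y = u @\<^sub>v w" "u \<in> ?F (Suc 0)" "w \<in> ?F 0"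
      using y(1) by (rule free_module_append_cases)
    have x: "x = D 0 *\<^sub>v u + f \<cdot>\<^sub>v w" using y(2) cone_map0 uw by simp
    have "D 0 *\<^sub>v u \<in> {v \<in> ?F 0. e \<bullet> v \<in> I}"
      unfolding resolution_exact_0[OF a] using uw(2) by auto
    then have "e \<bullet> (D 0 *\<^sub>v u) \<in> I" by simp
    then have "e \<bullet> x \<in> ?I"
      unfolding x aug[OF DF[OF uw(2)] uw(3)] using free_module_scalar_prod[OF e uw(3)] by blast
    moreover have "x \<in> ?F 0"
      unfolding x by (intro free_module_add free_module_smult DF uw fc)
    ultimately show "x \<in> {v \<in> ?F 0. e \<bullet> v \<in> ?I}" by blast
  qed
  have exact: "{x \<in> free_module m (length (a (Suc i)) + length (a i)).
        cone_map f a D i *\<^sub>v x = 0\<^sub>v (length (cone_shifts d a i))} =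
      (\<lambda>w. cone_map f a D (Suc i) *\<^sub>v w) ` free_module m (length (a (Suc (Suc i))) + length (a (Suc i)))" for i
  proof -
    have P: "prev_map a D i *\<^sub>v w \<in> carrier_vec (length (prev_shifts d a i))" if "w \<in> ?F i" for w
      using prev_map_carrier_mat[OF a] fmc[OF that] by (rule mult_mat_vec_carrier)
    have zero_iff: "cone_map f a D i *\<^sub>v (v @\<^sub>v w) = 0\<^sub>v (length (cone_shifts d a i)) \<longleftrightarrow>
        D i *\<^sub>v v + f \<cdot>\<^sub>v w = 0\<^sub>v (length (a i)) \<and> prev_map a D i *\<^sub>v w = 0\<^sub>v (length (prev_shifts d a i))"
      if v: "v \<in> ?F (Suc i)" and w: "w \<in> ?F i" for v w
    proof -
      have "0\<^sub>v (length (cone_shifts d a i)) = 0\<^sub>v (length (a i)) @\<^sub>v (0\<^sub>v (length (prev_shifts d a i)) :: 'a pol vec)"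
        by (intro eq_vecI) (auto simp: cone_shifts_def)
      moreover have "D i *\<^sub>v v + f \<cdot>\<^sub>v w \<in> carrier_vec (length (a i))"
        using fmc[OF DF[OF v]] fmc[OF w] by simp
      moreover have "- x = 0\<^sub>v r \<longleftrightarrow> x = 0\<^sub>v r" if "x \<in> carrier_vec r" for x :: "'a pol vec" and r
        using that by (metis uminus_uminus_vec uminus_zero_vec)
      ultimately show ?thesis
        unfolding cone_map_append[OF a fmc[OF v] fmc[OF w]] using P[OF w] by simp
    qed
    have cone_Suc: "cone_map f a D (Suc i) *\<^sub>v (z @\<^sub>v u) = (D (Suc i) *\<^sub>v z + f \<cdot>\<^sub>v u) @\<^sub>v - (D i *\<^sub>v u)"
      if "z \<in> ?F (Suc (Suc i))" "u \<in> ?F (Suc i)" for z u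
      using cone_map_append[OF a fmc[OF that(1)] fmc[OF that(2)]] by simp
    show ?thesis
    proof (intro subset_antisym subsetI)
      fix x assume "x \<in> {x \<in> free_module m (length (a (Suc i)) + length (a i)).
        cone_map f a D i *\<^sub>v x = 0\<^sub>v (length (cone_shifts d a i))}"
      then have x: "x \<in> free_module m (length (a (Suc i)) + length (a i))"
        "cone_map f a D i *\<^sub>v x = 0\<^sub>v (length (cone_shifts d a i))" by auto
      obtain v w where vw: "x = v @\<^sub>v w" "v \<in> ?F (Suc i)" "w \<in> ?F i"
        using x(1) by (rule free_module_append_cases)
      have cyc: "D i *\<^sub>v v + f \<cdot>\<^sub>v w = 0\<^sub>v (length (a i))" "prev_map a D i *\<^sub>v w = 0\<^sub>v (length (prev_shifts 0 a i))"
        using x(2) zero_iff[OF vw(2,3)] vw(1) by (auto simp: length_prev_shifts)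
      obtain u where u: "u \<in> ?F (Suc i)" "w = D i *\<^sub>v u"
        using cone_cycle_lifts[OF I a nzd vw(2,3) cyc] by blast
      let ?y = "v + f \<cdot>\<^sub>v u"
      have y: "?y \<in> ?F (Suc i)" by (intro free_module_add free_module_smult vw(2) u(1) fc)
      have "D i *\<^sub>v ?y = D i *\<^sub>v v + f \<cdot>\<^sub>v w"
        using mult_add_distrib_mat_vec[OF cD[of i] fmc[OF vw(2)], of "f \<cdot>\<^sub>v u"]
          mult_mat_vec_smult[OF cD[of i] fmc[OF u(1)], of f] fmc[OF u(1)] u(2) by simp
      then have "?y \<in> {v \<in> ?F (Suc i). D i *\<^sub>v v = 0\<^sub>v (length (a i))}" using y cyc(1) by simp
      then obtain z where z: "z \<in> ?F (Suc (Suc i))" "?y = D (Suc i) *\<^sub>v z"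
        unfolding resolution_exact[OF a] by auto
      have "cone_map f a D (Suc i) *\<^sub>v (z @\<^sub>v - u) = x"
        unfolding cone_Suc[OF z(1) free_module_uminus[OF u(1)]] z(2)[symmetric]
          smult_uminus_add[OF fmc[OF u(1)] fmc[OF vw(2)]] mult_mat_vec_uminus[OF cD fmc[OF u(1)]]
        using u(2) vw(1) by simp
      then show "x \<in> (\<lambda>w. cone_map f a D (Suc i) *\<^sub>v w) ` free_module m (length (a (Suc (Suc i))) + length (a (Suc i)))"
        using free_module_append[OF z(1) free_module_uminus[OF u(1)]] by blast
    next
      fix x assume "x \<in> (\<lambda>w. cone_map f a D (Suc i) *\<^sub>v w) ` free_module m (length (a (Suc (Suc i))) + length (a (Suc i)))"
      then obtain y where y: "y \<in> free_module m (length (a (Suc (Suc i))) + length (a (Suc i)))"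
        "x = cone_map f a D (Suc i) *\<^sub>v y" by blast
      obtain z u where zu: "y = z @\<^sub>v u" "z \<in> ?F (Suc (Suc i))" "u \<in> ?F (Suc i)"
        using y(1) by (rule free_module_append_cases)
      let ?v = "D (Suc i) *\<^sub>v z + f \<cdot>\<^sub>v u" and ?w = "- (D i *\<^sub>v u)"
      have v: "?v \<in> ?F (Suc i)" by (intro free_module_add free_module_smult DF zu(2,3) fc)
      have w: "?w \<in> ?F i" by (intro free_module_uminus DF zu(3))
      have x: "x = ?v @\<^sub>v ?w" using y(2) zu cone_Suc by simp
      have "D (Suc i) *\<^sub>v z \<in> {v \<in> ?F (Suc i). D i *\<^sub>v v = 0\<^sub>v (length (a i))}"
        unfolding resolution_exact[OF a] using zu(2) by blast
      then have "D i *\<^sub>v (D (Suc i) *\<^sub>v z) = 0\<^sub>v (length (a i))" by simp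
      then have "D i *\<^sub>v ?v = f \<cdot>\<^sub>v (D i *\<^sub>v u)"
        using mult_add_distrib_mat_vec[OF cD[of i] fmc[OF DF[OF zu(2)]], of "f \<cdot>\<^sub>v u"]
          mult_mat_vec_smult[OF cD[of i] fmc[OF zu(3)], of f] fmc[OF zu(3)] fmc[OF DF[OF zu(3)]] by simp
      moreover have "f \<cdot>\<^sub>v y + f \<cdot>\<^sub>v (- y) = 0\<^sub>v r" if "y \<in> carrier_vec r" for y r
        using that by (intro eq_vecI) auto
      note this[OF fmc[OF DF[OF zu(3)]]]
      ultimately have "D i *\<^sub>v ?v + f \<cdot>\<^sub>v ?w = 0\<^sub>v (length (a i))" by simp
      moreover have "prev_map a D i *\<^sub>v ?w = 0\<^sub>v (length (prev_shifts d a i))"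
        using mult_mat_vec_uminus[OF prev_map_carrier_mat[OF a] fmc[OF DF[OF zu(3)]]]
          prev_map_complex[OF a zu(3), of d] by simp
      ultimately show "x \<in> {x \<in> free_module m (length (a (Suc i)) + length (a i)).
        cone_map f a D i *\<^sub>v x = 0\<^sub>v (length (cone_shifts d a i))}"
        using zero_iff[OF v w] free_module_append[OF v w] x by simp
    qed
  qed
  show ?thesis
    unfolding graded_free_resolution_def
  proof (intro conjI)
    show "e \<in> carrier_vec (length (cone_shifts d a 0))"
      unfolding cone0 by (rule resolution_aug_carrier[OF a])
    show "\<forall>k<length (cone_shifts d a 0). e $ k \<in> graded_piece m (cone_shifts d a 0 ! k)"
      using resolution_aug_graded[OF a] by (simp add: cone_shifts_def)
    show "\<forall>i. cone_map f a D i \<in> carrier_mat (length (cone_shifts d a i)) (length (cone_shifts d a (Suc i))) \<and>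
      (\<forall>k<length (cone_shifts d a i). \<forall>l<length (cone_shifts d a (Suc i)).
        cone_map f a D i $$ (k, l) \<in> graded_piece m (cone_shifts d a (Suc i) ! l - cone_shifts d a i ! k))"
      by (rule maps)
    show "\<forall>g\<in>carrier (poly_ring m). \<exists>v\<in>free_module m (length (cone_shifts d a 0)). g - e \<bullet> v \<in> ?I"
      unfolding cone0 using surj by (rule ballI)
    show "{v \<in> free_module m (length (cone_shifts d a 0)). e \<bullet> v \<in> ?I} =
      (\<lambda>w. cone_map f a D 0 *\<^sub>v w) ` free_module m (length (cone_shifts d a 1))"
      unfolding cone0 coneSuc One_nat_def by (rule exact0)
    show "\<forall>i. {v \<in> free_module m (length (cone_shifts d a (Suc i))).
        cone_map f a D i *\<^sub>v v = 0\<^sub>v (length (cone_shifts d a i))} =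
      (\<lambda>w. cone_map f a D (Suc i) *\<^sub>v w) ` free_module m (length (cone_shifts d a (Suc (Suc i))))"
      unfolding coneSuc using exact by (rule allI)
  qed
qed

lemma mapping_cone_minimal:
  assumes a: "minimal_graded_free_resolution m I a e D" and f: "f \<in> irrelevant_ideal m"
  shows "elements_mat (cone_map f a D i) \<subseteq> irrelevant_ideal m"
proof
  have res: "graded_free_resolution m I a e D" and min: "elements_mat (D i) \<subseteq> irrelevant_ideal m" for i
    using a by (simp_all add: minimal_graded_free_resolution_def)
  note D = graded_maps_carrier_mat[OF resolution_maps[OF res]]
  note P = prev_map_carrier_mat[OF res, of i 0]
  have zero: "0 \<in> irrelevant_ideal m" by (simp add: irrelevant_ideal_def)
  have Dmin: "D j $$ (k, l) \<in> irrelevant_ideal m" if "k < length (a j)" "l < length (a (Suc j))" for j k l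
    using min[of j] elements_matI[OF D that refl] by blast
  have Pmin: "prev_map a D i $$ (k, l) \<in> irrelevant_ideal m"
    if "k < length (prev_shifts 0 a i)" "l < length (a i)" for k l
    using that Dmin by (cases i) auto
  fix x assume "x \<in> elements_mat (cone_map f a D i)"
  then obtain k l where "k < dim_row (cone_map f a D i)" "l < dim_col (cone_map f a D i)"
    "x = cone_map f a D i $$ (k, l)" by blast
  then have kl: "k < length (a i) + length (prev_shifts 0 a i)" "l < length (a (Suc i)) + length (a i)"
    "x = cone_map f a D i $$ (k, l)"
    using D[of i] P by (simp_all add: cone_map_def)
  then have "x = (if k < length (a i)
       then if l < length (a (Suc i)) then D i $$ (k, l)
         else if k = l - length (a (Suc i)) then f else 0
       else if l < length (a (Suc i)) then 0
         else - (prev_map a D i $$ (k - length (a i), l - length (a (Suc i)))))"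
    unfolding cone_map_def using D[of i] P by (simp add: index_mat_four_block)
  moreover have "- y \<in> irrelevant_ideal m" if "y \<in> irrelevant_ideal m" for y :: "'a pol"
    using that by (auto simp: irrelevant_ideal_def)
  ultimately show "x \<in> irrelevant_ideal m"
    using kl(1,2) f zero Dmin[of k i l] Pmin by (auto split: if_splits)
qed

section \<open>Disjoint unions of edges\<close>

definition matching :: "nat \<Rightarrow> nat set set" where
  "matching k = {{2 * l + 1, 2 * l + 2} | l. l < k}"

lemma matching_0 [simp]: "matching 0 = {}"
  by (simp add: matching_def)

lemma matching_edge_less_iff:
  assumes "i < j"
  shows "{i, j} \<in> matching k \<longleftrightarrow> (\<exists>l<k. i = 2 * l + 1 \<and> j = 2 * l + 2)"
  using assms by (auto simp: matching_def doubleton_eq_iff)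

lemma simple_graph_matching: "2 * k \<le> m \<Longrightarrow> simple_graph m (matching k)"
  by (auto simp: simple_graph_def matching_def)

lemma connected_in_matching_iff:
  "connected_in (matching k) i j \<longleftrightarrow> i = j \<or> {i, j} \<in> matching k"
proof
  have unique: "u = w" if "{u, v} \<in> matching k" "{v, w} \<in> matching k" for u v w
    using that by (auto simp: matching_def doubleton_eq_iff) presburger+
  assume "connected_in (matching k) i j"
  then have "(i, j) \<in> {(u, v). {u, v} \<in> matching k}\<^sup>*" by (simp add: connected_in_def)
  then show "i = j \<or> {i, j} \<in> matching k"
    by induction (use unique in auto)
qed (auto simp: connected_in_def)

lemma binomial_edge_ideal_matching_eq_P_empty:
  assumes "2 * k \<le> m"
  shows "binomial_edge_ideal m (matching k) = (P_empty m (matching k) :: 'k::comm_ring_1 pol set)"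
proof -
  have "{i, j} \<in> matching k \<and> i < j \<longleftrightarrow>
      i \<in> {1..m} \<and> j \<in> {1..m} \<and> i < j \<and> connected_in (matching k) i j" for i j
    using assms by (auto simp: connected_in_matching_iff matching_edge_less_iff)
  then show ?thesis unfolding binomial_edge_ideal_def P_empty_def by simp
qed

lemma genideal_insert:
  fixes f :: "'k::comm_ring_1 pol"
  assumes A: "A \<subseteq> carrier (poly_ring m)" and f: "f \<in> carrier (poly_ring m)"
  shows "genideal (poly_ring m) (insert f A) =
    {g + h * f | g h. g \<in> genideal (poly_ring m) A \<and> h \<in> carrier (poly_ring m)}" (is "?L = ?R")
proof
  note I = ring.genideal_ideal[OF ring_poly_ring A]
  note self = ring.genideal_self[OF ring_poly_ring A]
  have fA: "insert f A \<subseteq> carrier (poly_ring m)" using A f by simp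
  note J = ring.genideal_ideal[OF ring_poly_ring fA]
  note Jself = ring.genideal_self[OF ring_poly_ring fA]
  have "ideal ?R (poly_ring m)"
  proof (rule ideal_poly_ringI)
    show "?R \<subseteq> carrier (poly_ring m)" using ideal_poly_subset[OF I] f by auto
    have "0 = 0 + 0 * f" by simp
    then show "0 \<in> ?R" using ideal_poly_0[OF I] poly_ring_0 by blast
    show "p + q \<in> ?R" if pq: "p \<in> ?R" "q \<in> ?R" for p q
    proof -
      obtain g h g' h' where "p = g + h * f" "q = g' + h' * f" "g \<in> genideal (poly_ring m) A"
        "g' \<in> genideal (poly_ring m) A" "h \<in> carrier (poly_ring m)" "h' \<in> carrier (poly_ring m)"
        using pq by blast
      then have "p + q = (g + g') + (h + h') * f" "g + g' \<in> genideal (poly_ring m) A"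
        "h + h' \<in> carrier (poly_ring m)"
        using ideal_poly_add[OF I] by (auto simp: algebra_simps)
      then show ?thesis by blast
    qed
    show "p * q \<in> ?R" if p: "p \<in> carrier (poly_ring m)" and q: "q \<in> ?R" for p q
    proof -
      obtain g h where "q = g + h * f" "g \<in> genideal (poly_ring m) A" "h \<in> carrier (poly_ring m)"
        using q by blast
      then have "p * q = p * g + (p * h) * f" "p * g \<in> genideal (poly_ring m) A"
        "p * h \<in> carrier (poly_ring m)"
        using ideal_poly_mult[OF I p] p by (auto simp: algebra_simps)
      then show ?thesis by blast
    qed
  qed
  moreover have "insert f A \<subseteq> ?R"
  proof
    fix p assume "p \<in> insert f A"
    then consider "p = 0 + 1 * f" | "p = p + 0 * f" "p \<in> genideal (poly_ring m) A"
      using self by auto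
    then show "p \<in> ?R"
      using ideal_poly_0[OF I] poly_ring_0 poly_ring_1 by cases blast+
  qed
  ultimately show "?L \<subseteq> ?R" by (rule ring.genideal_minimal[OF ring_poly_ring])
  have "genideal (poly_ring m) A \<subseteq> ?L"
    using Jself by (intro ring.genideal_minimal[OF ring_poly_ring J]) simp
  then show "?R \<subseteq> ?L"
    using ideal_poly_add[OF J] ideal_poly_mult[OF J] Jself by auto
qed

text \<open>
  The polynomial ring, in homological degree \<open>0\<close>, resolves itself; this starts the iteration of cones.
\<close>
lemma zero_ideal_resolution:
  "minimal_graded_free_resolution m {0 :: 'k::comm_ring_1 pol} (\<lambda>i. if i = 0 then [0] else [])
    (vec 1 (\<lambda>_. 1)) (\<lambda>i. 0\<^sub>m (if i = 0 then 1 else 0) 0)"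
  (is "minimal_graded_free_resolution m _ ?a ?e ?D")
proof -
  have aug: "?e \<bullet> v = v $ 0" if "v \<in> carrier_vec 1" for v :: "'k pol vec"
    using that by (simp add: scalar_prod_def)
  have F0: "free_module m 0 = {vNil :: 'k pol vec}"
    by (auto simp: free_module_def)
  have zero: "v = 0\<^sub>v 1 \<longleftrightarrow> v $ 0 = 0" if "v \<in> carrier_vec 1" for v :: "'k pol vec"
    using that by (auto intro!: eq_vecI)
  have surj: "\<exists>v\<in>free_module m 1. g - ?e \<bullet> v \<in> {0}" if "g \<in> carrier (poly_ring m)" for g :: "'k pol"
    using that by (intro bexI[of _ "vec 1 (\<lambda>_. g)"]) (simp_all add: scalar_prod_def free_module_def)
  have exact0: "{v \<in> free_module m 1. ?e \<bullet> v \<in> {0}} = (\<lambda>w. 0\<^sub>m 1 0 *\<^sub>v w) ` free_module m 0"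
  proof -
    have "{v \<in> free_module m 1. ?e \<bullet> v \<in> {0}} = {0\<^sub>v 1}"
      using aug zero by (auto simp: free_module_def)
    moreover have "0\<^sub>m 1 0 *\<^sub>v vNil = (0\<^sub>v 1 :: 'k pol vec)" by (intro eq_vecI) auto
    ultimately show ?thesis unfolding F0 by simp
  qed
  have exact: "{v \<in> free_module m 0. 0\<^sub>m r 0 *\<^sub>v v = (0\<^sub>v r :: 'k pol vec)} = (\<lambda>w. 0\<^sub>m 0 0 *\<^sub>v w) ` free_module m 0" for r
  proof -
    have "0\<^sub>m r 0 *\<^sub>v vNil = (0\<^sub>v r :: 'k pol vec)" for r by (intro eq_vecI) auto
    from this[of r] this[of 0] show ?thesis unfolding F0 by auto
  qed
  have "graded_free_resolution m {0} ?a ?e ?D"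
    unfolding graded_free_resolution_def using surj exact0 exact[of 0] exact[of 1] by simp
  moreover have "elements_mat (?D i) \<subseteq> irrelevant_ideal m" for i
    by (auto simp: elements_mat_def)
  ultimately show ?thesis by (simp add: minimal_graded_free_resolution_def)
qed

lemma hcomp_adjoin_form:
  assumes hom: "\<And>p d. p \<in> I \<Longrightarrow> hcomp d p \<in> I" and f: "f \<in> graded_piece m c"
    and p: "p \<in> {g + h * f | g h. g \<in> I \<and> h \<in> carrier (poly_ring m)}"
  shows "hcomp d p \<in> {g + h * f | g h. g \<in> I \<and> h \<in> carrier (poly_ring m)}"
proof -
  obtain g h where p: "p = g + h * f" "g \<in> I" "h \<in> carrier (poly_ring m)" using p by auto
  have "hcomp d p = hcomp d g + hcomp (d - c) h * f"
    using hcomp_mult[OF f, of d h] by (simp add: p(1) hcomp_add mult.commute)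
  then show ?thesis using hom[OF p(2)] hcomp_in_graded_piece[OF p(3)] graded_piece_subset by blast
qed

lemma f_pol_irrelevant:
  "i \<in> {1..m} \<Longrightarrow> j \<in> {1..m} \<Longrightarrow> f_pol i j \<in> irrelevant_ideal m"
  using f_pol_graded[of i m j]
  by (auto simp: irrelevant_ideal_def graded_piece_def in_keys_iff dest: bspec[of _ _ 0])

lemma matching_gens:
  "{f_pol i j | i j. {i, j} \<in> matching k \<and> i < j} = (\<lambda>l. f_pol (2 * l + 1) (2 * l + 2)) ` {..<k}"
proof -
  have "{i, j} \<in> matching k \<and> i < j \<longleftrightarrow> (\<exists>l<k. i = 2 * l + 1 \<and> j = 2 * l + 2)" for i j
    using matching_edge_less_iff[of i j k] by auto
  then show ?thesis by (simp only:) blast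
qed

lemma matching_gens_subset:
  assumes "2 * k \<le> m"
  shows "{f_pol i j | i j. {i, j} \<in> matching k \<and> i < j} \<subseteq> carrier (poly_ring m)"
  unfolding matching_gens using assms by (auto intro!: f_pol_carrier)

text \<open>
  The ideal of the first \<open>k\<close> edges is prime and does not contain the generator of the next edge, as that
  edge joins two components of the smaller graph. So each further edge contributes one mapping cone,
  and the shifts in degree \<open>i\<close> are those in degree \<open>i\<close> together with those in degree \<open>i - 1\<close> raised
  by \<open>2\<close>. Homogeneity of the ideal is carried along for the uniqueness of the resolution.
\<close>
lemma matching_resolution:
  assumes "2 * k \<le> m"
  shows "\<exists>a e D. minimal_graded_free_resolution m (binomial_edge_ideal m (matching k) :: 'k::idom pol set) a e D \<and>
    (\<forall>i. set (a i) = (if i \<le> k then {2 * int i} else {})) \<and>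
    (\<forall>p\<in>binomial_edge_ideal m (matching k) :: 'k pol set. \<forall>d. hcomp d p \<in> binomial_edge_ideal m (matching k))"
  using assms
proof (induction k)
  case 0
  have "genideal (poly_ring m) {} = {0 :: 'k pol}"
  proof (intro subset_antisym)
    have "ideal {0 :: 'k pol} (poly_ring m)" by (rule ideal_poly_ringI) auto
    then show "genideal (poly_ring m) {} \<subseteq> {0 :: 'k pol}"
      by (rule ring.genideal_minimal[OF ring_poly_ring]) simp
    show "{0 :: 'k pol} \<subseteq> genideal (poly_ring m) {}"
      by (simp add: ideal_poly_0[OF ring.genideal_ideal[OF ring_poly_ring]])
  qed
  then have "binomial_edge_ideal m (matching 0) = {0 :: 'k pol}"
    by (simp add: binomial_edge_ideal_def)
  then show ?case
    using zero_ideal_resolution[of m, where ?'k = 'k]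
    by (intro exI conjI) (auto)
next
  case (Suc k)
  let ?J = "\<lambda>k. binomial_edge_ideal m (matching k) :: 'k pol set"
  let ?f = "f_pol (2 * k + 1) (2 * k + 2) :: 'k pol"
  have k: "2 * k \<le> m" "2 * k + 1 \<in> {1..m}" "2 * k + 2 \<in> {1..m}" using Suc.prems by auto
  from Suc.IH[OF k(1)] obtain a e D where a: "minimal_graded_free_resolution m (?J k) a e D"
    and sh: "\<And>i. set (a i) = (if i \<le> k then {2 * int i} else {})"
    and hom: "\<And>p d. p \<in> ?J k \<Longrightarrow> hcomp d p \<in> ?J k" by blast
  have prime: "primeideal (?J k) (poly_ring m)"
    unfolding binomial_edge_ideal_matching_eq_P_empty[OF k(1)] by (rule primeideal_P_empty)
  have I: "ideal (?J k) (poly_ring m)" using prime by (rule primeideal.axioms(1))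
  have "{2 * k + 1, 2 * k + 2} \<notin> matching k" by (auto simp: matching_edge_less_iff)
  then have "\<not> connected_in (matching k) (2 * k + 1) (2 * k + 2)"
    by (simp add: connected_in_matching_iff)
  then have notin: "?f \<notin> ?J k"
    unfolding binomial_edge_ideal_matching_eq_P_empty[OF k(1)] using k
    by (subst f_pol_in_P_empty_iff) auto
  have nzd: "h \<in> ?J k" if "h \<in> carrier (poly_ring m)" "h * ?f \<in> ?J k" for h
    using primeideal.I_prime[OF prime that(1) f_pol_carrier[OF k(2,3)]] that(2) notin by auto
  have "{f_pol i j | i j. {i, j} \<in> matching (Suc k) \<and> i < j} =
      insert ?f {f_pol i j | i j. {i, j} \<in> matching k \<and> i < j}"
    by (simp only: matching_gens lessThan_Suc image_insert)
  then have J: "?J (Suc k) = {g + h * ?f | g h. g \<in> ?J k \<and> h \<in> carrier (poly_ring m)}"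
    unfolding binomial_edge_ideal_def
    by (simp only: genideal_insert[OF matching_gens_subset[OF k(1)] f_pol_carrier[OF k(2,3)]])
  have "graded_free_resolution m (?J (Suc k)) (cone_shifts 2 a) e (cone_map ?f a D)"
    unfolding J using a
    by (intro mapping_cone_resolution[OF I _ f_pol_graded[OF k(2,3)] nzd])
      (auto simp: minimal_graded_free_resolution_def)
  then have "minimal_graded_free_resolution m (?J (Suc k)) (cone_shifts 2 a) e (cone_map ?f a D)"
    using mapping_cone_minimal[OF a f_pol_irrelevant[OF k(2,3)]]
    by (simp add: minimal_graded_free_resolution_def)
  moreover have "set (cone_shifts 2 a i) = (if i \<le> Suc k then {2 * int i} else {})" for i
    by (cases i) (auto simp: cone_shifts_def sh)
  moreover have "\<forall>p\<in>?J (Suc k). \<forall>d. hcomp d p \<in> ?J (Suc k)"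
    unfolding J using hcomp_adjoin_form[OF hom f_pol_graded[OF k(2,3)]] by blast
  ultimately show ?case by blast
qed

lemma regularity_matching:
  assumes "2 * k \<le> m"
  shows "regularity m (binomial_edge_ideal m (matching k) :: 'k::field pol set) = int k"
proof -
  let ?J = "binomial_edge_ideal m (matching k) :: 'k pol set"
  obtain a e D where a: "minimal_graded_free_resolution m ?J a e D"
    and sh: "\<And>i. set (a i) = (if i \<le> k then {2 * int i} else {})"
    and hom: "\<And>p d. p \<in> ?J \<Longrightarrow> hcomp d p \<in> ?J"
    using matching_resolution[OF assms, where ?'k = 'k] by blast
  have I: "ideal ?J (poly_ring m)"
    unfolding binomial_edge_ideal_def
    by (rule ring.genideal_ideal[OF ring_poly_ring matching_gens_subset[OF assms]])
  have "{j - int i | i j. j \<in> set (a i)} = int ` {..k}"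
    by (auto simp: sh split: if_splits)
  then have "regularity m ?J = Max (int ` {..k})"
    using regularity_eqI[OF I hom a] by simp
  also have "\<dots> = int k" by (rule Max_eqI) auto
  finally show ?thesis .
qed

lemma prime_ideal_v_zero:
  fixes I :: "'k::comm_ring_1 pol set"
  assumes "primeideal I (poly_ring m)"
  shows v_at_prime_ideal: "v_at m I I = 0" and v_number_prime_ideal: "v_number m I = 0"
proof -
  have "I \<subseteq> carrier (poly_ring m)"
    using ideal_poly_subset primeideal.axioms(1)[OF assms] by blast
  then have colon: "colon m I 1 = I" by (auto simp: colon_def)
  have "(1 :: 'k pol) \<in> graded_piece m (int 0)" by simp
  then show v: "v_at m I I = 0"
    unfolding v_at_def using colon by (intro Least_eq_0) blast
  have "(1 :: 'k pol) \<in> carrier (poly_ring m)" by simp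
  then have "I \<in> Ass m I" unfolding Ass_def using assms colon by blast
  then show "v_number m I = 0"
    unfolding v_number_def using v by (intro Least_eq_0) force
qed

theorem theorem4p11:
  shows "(\<forall>n::nat. \<exists>m E. 1 \<le> m \<and> simple_graph m E \<and>
            regularity m (binomial_edge_ideal m E :: 'k::field pol set)
              - int (v_number m (binomial_edge_ideal m E :: 'k pol set)) = int n) \<and>
         (\<forall>n::nat. \<exists>m E. 1 \<le> m \<and> simple_graph m E \<and>
            regularity m (binomial_edge_ideal m E :: 'k pol set)
              - int (v_empty m E (binomial_edge_ideal m E :: 'k pol set)) = int n)"
proof -
  have witness: "1 \<le> 2 * n + 1 \<and> simple_graph (2 * n + 1) (matching n) \<and>
      regularity (2 * n + 1) (binomial_edge_ideal (2 * n + 1) (matching n) :: 'k pol set) = int n \<and>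
      v_number (2 * n + 1) (binomial_edge_ideal (2 * n + 1) (matching n) :: 'k pol set) = 0 \<and>
      v_empty (2 * n + 1) (matching n) (binomial_edge_ideal (2 * n + 1) (matching n) :: 'k pol set) = 0" for n
  proof -
    have le: "2 * n \<le> 2 * n + 1" by simp
    note eq = binomial_edge_ideal_matching_eq_P_empty[OF le, where ?'k = 'k]
    have prime: "primeideal (P_empty (2 * n + 1) (matching n)) (poly_ring (2 * n + 1) :: 'k pol ring)"
      by (rule primeideal_P_empty)
    show ?thesis
      unfolding v_empty_def eq
      using simple_graph_matching[OF le] regularity_matching[OF le, where ?'k = 'k, unfolded eq]
        v_number_prime_ideal[OF prime] v_at_prime_ideal[OF prime]
      by simp
  qed
  show ?thesis
  proof (intro conjI allI)
    fix n :: nat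
    show "\<exists>m E. 1 \<le> m \<and> simple_graph m E \<and>
        regularity m (binomial_edge_ideal m E :: 'k pol set)
          - int (v_number m (binomial_edge_ideal m E :: 'k pol set)) = int n"
      using witness[of n] by (intro exI[of _ "2 * n + 1"] exI[of _ "matching n"]) simp
    show "\<exists>m E. 1 \<le> m \<and> simple_graph m E \<and>
        regularity m (binomial_edge_ideal m E :: 'k pol set)
          - int (v_empty m E (binomial_edge_ideal m E :: 'k pol set)) = int n"
      using witness[of n] by (intro exI[of _ "2 * n + 1"] exI[of _ "matching n"]) simp
  qed
qed

end
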